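(* Let $N\ge1$ be an integer and $\beta>0$, and consider the Glauber dynamics of the Curie–Weiss model on $\Omega=\{-1,1\}^N$. Assume that $$(N-1)\big(\exp(2\beta/N)-1\big)\le1 .$$ Let $$f_{\mathrm{CW},\beta,N}(m)=e^{-\frac\beta N(N-1-2m)}\big[1-(N-1-m)(e^{2\beta/N}-1)\big]+e^{\frac\beta N(N-1-2m)}\big[1-m(e^{2\beta/N}-1)\big],$$ $$\kappa=f_{\mathrm{CW},\beta,N}\big(\lfloor(N-1)/2\rfloor\big),\qquad\bar\kappa=\exp\Big(-\frac\beta N(N-1)\Big)\big[1-(N-1)(\exp(2\beta/N)-1)\big].$$ Then: (i) for every admissible $\phi$ the convex Sobolev inequality holds with $\kappa_\phi=\kappa$; (ii) the modified logarithmic Sobolev inequality holds with $\kappa_1=\kappa+2\bar\kappa$; (iii) for every $\alpha\in(1,2]$ the Beckner inequality holds with $\kappa_\alpha=\alpha\kappa$. In particular, if $N$ is odd, $f_{\mathrm{CW},\beta,N}(\lfloor(N-1)/2\rfloor)=2\big(1-\frac{N-1}2(\exp(2\beta/N)-1)\big)$.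
   Context: Curie–Weiss model: moves $G=\{\sigma_i\}_{i=1,\dots,N}$, where $\sigma_i$ flips the sign of the $i$-th coordinate of $\eta\in\{-1,1\}^N$; Hamiltonian $H(\eta)=-\frac1{2N}\sum_{i,j=1}^N\eta_i\eta_j$; rates $c(\eta,\sigma_i)=\exp(-\frac\beta2(H(\sigma_i\eta)-H(\eta)))=\exp(-\beta\eta_i\,m_i(\eta))$ with $m_i(\eta)=\frac1N\sum_{j\ne i}\eta_j$; generator $\mathcal Lf(\eta)=\sum_ic(\eta,\sigma_i)(f(\sigma_i\eta)-f(\eta))$; reversible probability measure $\mathbf m(\eta)=\frac1{Z_\beta}\exp(-\beta H(\eta))$. $\phi:[0,\infty)\to[0,\infty)$ is admissible if it is convex, twice differentiable on $(0,\infty)$, and $\Phi(a,b):=(\phi'(b)-\phi'(a))(b-a)$ is convex on $(0,\infty)^2$. $\mathcal H^\phi(f|\mathbf m)=\sum_\eta\phi(f(\eta))\mathbf m(\eta)-\phi\big(\sum_\eta f(\eta)\mathbf m(\eta)\big)$. The convex Sobolev inequality with constant $\kappa_\phi$ is: for all $f:\Omega\to(0,\infty)$, $$\kappa_\phi\,\mathcal H^\phi(f|\mathbf m)\le\frac12\sum_{\eta\in\Omega,\sigma\in G}c(\eta,\sigma)\,\Phi(f(\eta),f(\sigma\eta))\,\mathbf m(\eta).$$ Let $\phi_1(a)=a\log a-a+1$ and $\phi_\alpha(a)=\frac{1}{\alpha-1}(a^\alpha-a)-a+1$ for $\alpha\in(1,2]$. The modified logarithmic Sobolev inequality with constant $\kappa_1$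 is the convex Sobolev inequality for $\phi=\phi_1$; the Beckner inequality with constant $\kappa_\alpha$ is the one for $\phi=\phi_\alpha$. *)

theory Defs
  imports "HOL-Analysis.Analysis"
begin

section \<open>Convex Sobolev inequalities for finite reversible Markov chains\<close>

definition Phi :: "(real \<Rightarrow> real) \<Rightarrow> real \<Rightarrow> real \<Rightarrow> real" where
  "Phi \<phi> a b = (deriv \<phi> b - deriv \<phi> a) * (b - a)"

text \<open>Functions on \<open>[0,\<infinity>)\<close> are total functions on the reals of which only the values on
  \<open>{0..}\<close> are constrained; derivatives are only taken at interior points.\<close>

definition admissible :: "(real \<Rightarrow> real) \<Rightarrow> bool" where
  "admissible \<phi> \<longleftrightarrow>
     (\<forall>a\<ge>0. \<phi> a \<ge> 0) \<and>
     convex_on {0..} \<phi> \<and>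
     (\<forall>a>0. \<phi> differentiable (at a) \<and> deriv \<phi> differentiable (at a)) \<and>
     convex_on ({0<..} \<times> {0<..}) (\<lambda>(a, b). Phi \<phi> a b)"

definition phi_entropy :: "'s set \<Rightarrow> ('s \<Rightarrow> real) \<Rightarrow> (real \<Rightarrow> real) \<Rightarrow> ('s \<Rightarrow> real) \<Rightarrow> real" where
  "phi_entropy S \<mu> \<phi> f = (\<Sum>x\<in>S. \<phi> (f x) * \<mu> x) - \<phi> (\<Sum>x\<in>S. f x * \<mu> x)"

text \<open>State space \<open>S\<close>, set of moves \<open>G\<close> (maps on states), jump rates \<open>c\<close>, measure \<open>\<mu>\<close>.\<close>

definition convex_Sobolev ::
  "'s set \<Rightarrow> ('s \<Rightarrow> 's) set \<Rightarrow> ('s \<Rightarrow> ('s \<Rightarrow> 's) \<Rightarrow> real) \<Rightarrow> ('s \<Rightarrow> real)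
     \<Rightarrow> (real \<Rightarrow> real) \<Rightarrow> real \<Rightarrow> bool" where
  "convex_Sobolev S G c \<mu> \<phi> \<kappa> \<longleftrightarrow>
     (\<forall>f. (\<forall>x\<in>S. f x > 0) \<longrightarrow>
        \<kappa> * phi_entropy S \<mu> \<phi> f
          \<le> 1 / 2 * (\<Sum>x\<in>S. \<Sum>\<sigma>\<in>G. c x \<sigma> * Phi \<phi> (f x) (f (\<sigma> x)) * \<mu> x))"

definition phi_log :: "real \<Rightarrow> real" where
  "phi_log a = a * ln a - a + 1"

definition phi_pow :: "real \<Rightarrow> real \<Rightarrow> real" where
  "phi_pow \<alpha> a = 1 / (\<alpha> - 1) * (a powr \<alpha> - a) - a + 1"

definition modified_log_Sobolev ::
  "'s set \<Rightarrow> ('s \<Rightarrow> 's) set \<Rightarrow> ('s \<Rightarrow> ('s \<Rightarrow> 's) \<Rightarrow> real) \<Rightarrow> ('s \<Rightarrow> real) \<Rightarrow> real \<Rightarrow> bool" where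
  "modified_log_Sobolev S G c \<mu> \<kappa> \<longleftrightarrow> convex_Sobolev S G c \<mu> phi_log \<kappa>"

definition Beckner ::
  "'s set \<Rightarrow> ('s \<Rightarrow> 's) set \<Rightarrow> ('s \<Rightarrow> ('s \<Rightarrow> 's) \<Rightarrow> real) \<Rightarrow> ('s \<Rightarrow> real)
     \<Rightarrow> real \<Rightarrow> real \<Rightarrow> bool" where
  "Beckner S G c \<mu> \<alpha> \<kappa> \<longleftrightarrow> convex_Sobolev S G c \<mu> (phi_pow \<alpha>) \<kappa>"


section \<open>Glauber dynamics of the Curie--Weiss model\<close>

type_synonym config = "nat \<Rightarrow> real"

definition configs :: "nat \<Rightarrow> config set" where
  "configs N = {1..N} \<rightarrow>\<^sub>E {-1, 1}"

definition flip :: "nat \<Rightarrow> config \<Rightarrow> config" where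
  "flip i \<eta> = \<eta>(i := - \<eta> i)"

definition moves :: "nat \<Rightarrow> (config \<Rightarrow> config) set" where
  "moves N = flip ` {1..N}"

definition H_CW :: "nat \<Rightarrow> config \<Rightarrow> real" where
  "H_CW N \<eta> = - (1 / (2 * real N)) * (\<Sum>i\<in>{1..N}. \<Sum>j\<in>{1..N}. \<eta> i * \<eta> j)"

definition rate_CW :: "real \<Rightarrow> nat \<Rightarrow> config \<Rightarrow> (config \<Rightarrow> config) \<Rightarrow> real" where
  "rate_CW \<beta> N \<eta> \<sigma> = exp (- (\<beta> / 2) * (H_CW N (\<sigma> \<eta>) - H_CW N \<eta>))"

definition Z_CW :: "real \<Rightarrow> nat \<Rightarrow> real" where
  "Z_CW \<beta> N = (\<Sum>\<eta>\<in>configs N. exp (- \<beta> * H_CW N \<eta>))"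

definition gibbs_CW :: "real \<Rightarrow> nat \<Rightarrow> config \<Rightarrow> real" where
  "gibbs_CW \<beta> N \<eta> = 1 / Z_CW \<beta> N * exp (- \<beta> * H_CW N \<eta>)"

lemma rate_CW_flip:
  assumes "i \<in> {1..N}"
  shows "rate_CW \<beta> N \<eta> (flip i) = exp (- \<beta> * \<eta> i * (1 / real N * (\<Sum>j\<in>{1..N} - {i}. \<eta> j)))"
proof -
  define s where "s = (\<Sum>j\<in>{1..N} - {i}. \<eta> j)"
  have H: "H_CW N \<xi> = - (1 / (2 * real N)) * (\<Sum>j\<in>{1..N}. \<xi> j)\<^sup>2" for \<xi>
    by (simp add: H_CW_def power2_eq_square sum_product)
  have a: "(\<Sum>j\<in>{1..N}. \<eta> j) = \<eta> i + s"
    unfolding s_def using assms by (simp add: sum.remove)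
  have "(\<Sum>j\<in>{1..N} - {i}. flip i \<eta> j) = s"
    unfolding s_def by (rule sum.cong) (auto simp: flip_def)
  then have b: "(\<Sum>j\<in>{1..N}. flip i \<eta> j) = - \<eta> i + s"
    using assms by (subst sum.remove[of _ i]) (auto simp: flip_def)
  have "real N > 0" using assms by auto
  then have "- (\<beta> / 2) * (H_CW N (flip i \<eta>) - H_CW N \<eta>) = - \<beta> * \<eta> i * (1 / real N * s)"
    unfolding H a b by (simp add: field_simps power2_eq_square)
  then show ?thesis unfolding rate_CW_def s_def by simp
qed

definition f_CW :: "real \<Rightarrow> nat \<Rightarrow> int \<Rightarrow> real" where
  "f_CW \<beta> N m =
     exp (- (\<beta> / real N) * (real N - 1 - 2 * of_int m))
       * (1 - (real N - 1 - of_int m) * (exp (2 * \<beta> / real N) - 1))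
   + exp (\<beta> / real N * (real N - 1 - 2 * of_int m))
       * (1 - of_int m * (exp (2 * \<beta> / real N) - 1))"

definition kappa_CW :: "real \<Rightarrow> nat \<Rightarrow> real" where
  "kappa_CW \<beta> N = f_CW \<beta> N \<lfloor>(real N - 1) / 2\<rfloor>"

definition kappa_bar_CW :: "real \<Rightarrow> nat \<Rightarrow> real" where
  "kappa_bar_CW \<beta> N =
     exp (- (\<beta> / real N) * (real N - 1)) * (1 - (real N - 1) * (exp (2 * \<beta> / real N) - 1))"

end

(* The semigroup is replaced by the iterates of P = 1 + h L with small h. By convexity of phi one
   step dissipates at most h E(f) of entropy, where E is the right-hand side of the inequality. So
   if E(P f) <= (1 - h k) E(f) for all f, then E - k H decreases along the iterates; since H tends
   to 0, k H(f) <= E(f).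

   The contraction of E comes from a coupling of the steps from x and from y = flip i x. A spin j
   other than i is flipped in both states at the smaller of its two rates; the excess is coupled
   with the flip of i in the other state. The remaining flips of i make the two states merge at
   total rate f_CW(n), where n is the number of other spins that agree with spin i; the smallness
   of beta is what makes the remaining rates nonnegative. By Jensen and reversibility all
   contributions to E other than those of the merging cancel, and f_CW is minimal at the middle.
   For phi_log and phi_pow merging contracts the density Phi more than convexity alone gives, and
   h tending to 0 removes the second-order term which this causes. *)

theory Submission imports Defs begin

section \<open>Convexity of the energy densities\<close>

text \<open>\<open>f_CW\<close> at n is the sum of the merging rates into the two states;
  \<open>kappa_CW\<close> is its minimum, and \<open>kappa_bar_CW\<close> is the least single
  merging rate, taken when all spins agree. \<open>Phi\<close> is the increment of f times the
  increment of phi'(f). Jensen contracts the product at rate \<open>kappa_CW\<close>. For the two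
  special families the first factor alone does so, and the second adds its own rate: 2 *
  \<open>kappa_bar_CW\<close> for the logarithm, since merging at equal rates pulls both arguments
  to their midpoint, and (\<alpha> - 1) * \<open>kappa_CW\<close> for the power \<alpha> - 1, by
  homogeneity. Hence the constants in (ii) and (iii). The cancellation takes place on the squares x,
  flip i x, flip j x, flip i (flip j x). The weight of an edge in direction i times the smaller rate
  of j is, up to \<open>Z_CW\<close>, the product of the square roots of the unnormalised Gibbs
  weights at the two corners where spins i and j differ; so all four edges of the square share it. E
  vanishes identically for affine phi, so its decay does not make the iterates converge.
  Convergence, and with it H tending to 0, comes from the energy with density (b - a)^2.\<close>

lemma convex_on_sum_base:
  fixes g :: "'a::real_vector \<Rightarrow> real"
  assumes g: "convex_on C g" and J: "finite J"
    and w: "\<And>j. j \<in> J \<Longrightarrow> w j \<ge> 0" "sum w J \<le> 1"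
    and p: "\<And>j. j \<in> J \<Longrightarrow> p j \<in> C" "z \<in> C"
  shows "g (z + (\<Sum>j\<in>J. w j *\<^sub>R (p j - z))) \<le> (\<Sum>j\<in>J. w j * g (p j)) + (1 - sum w J) * g z"
proof -
  \<comment> \<open>The index \<open>None\<close> carries the weight that \<open>w\<close> leaves
    over, at the base point \<open>z\<close>.\<close>
  define K where "K = insert None (Some ` J)"
  define v where "v = (\<lambda>k. case k of None \<Rightarrow> 1 - sum w J | Some j \<Rightarrow> w j)"
  define q where "q = (\<lambda>k. case k of None \<Rightarrow> z | Some j \<Rightarrow> p j)"
  have K: "(\<Sum>k\<in>K. (r k :: 'c::comm_monoid_add)) = r None + (\<Sum>j\<in>J. r (Some j))" for r
    using J by (simp add: K_def sum.reindex)
  have "g (\<Sum>k\<in>K. v k *\<^sub>R q k) \<le> (\<Sum>k\<in>K. v k * g (q k))"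
  proof (rule convex_on_sum[OF _ _ g])
    show "sum v K = 1" by (simp add: K v_def)
  qed (use J w p in \<open>auto simp: K_def v_def q_def\<close>)
  moreover have "(\<Sum>k\<in>K. v k *\<^sub>R q k) = z + (\<Sum>j\<in>J. w j *\<^sub>R (p j - z))"
    by (simp add: K v_def q_def scaleR_diff_left scaleR_diff_right sum_subtractf scaleR_sum_left)
  moreover have "(\<Sum>k\<in>K. v k * g (q k)) = (\<Sum>j\<in>J. w j * g (p j)) + (1 - sum w J) * g z"
    by (simp add: K v_def q_def)
  ultimately show ?thesis by simp
qed

section \<open>Hessian criterion for the densities, with the quadratic and logarithmic
  instances\<close>

lemma quadratic_form_nonneg:
  fixes A B D u v :: real
  assumes "A > 0" "B\<^sup>2 \<le> A * D"
  shows "A * u\<^sup>2 + 2 * B * (u * v) + D * v\<^sup>2 \<ge> 0"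
proof -
  have "A * (A * u\<^sup>2 + 2 * B * (u * v) + D * v\<^sup>2) = (A * u + B * v)\<^sup>2 + (A * D - B\<^sup>2) * v\<^sup>2"
    by (simp add: power2_eq_square algebra_simps)
  also have "\<dots> \<ge> 0" using assms by simp
  finally show ?thesis using assms(1) by (simp add: zero_le_mult_iff)
qed

lemma convex_quadrant: "convex ({0<..} \<times> {0<..} :: (real \<times> real) set)"
  by (intro convex_Times convex_real_interval)

text \<open>The hypotheses say that the Hessian of \<open>(a, b) \<mapsto> (g b - g a) (b - a)\<close> is positive
  semidefinite.\<close>
lemma convex_on_increment_product:
  fixes g g' g'' :: "real \<Rightarrow> real"
  assumes g: "\<And>x. x > 0 \<Longrightarrow> (g has_real_derivative g' x) (at x)"
    and g': "\<And>x. x > 0 \<Longrightarrow> (g' has_real_derivative g'' x) (at x)"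
    and trace: "\<And>a b. a > 0 \<Longrightarrow> b > 0 \<Longrightarrow> 2 * g' a - g'' a * (b - a) > 0"
    and det: "\<And>a b. a > 0 \<Longrightarrow> b > 0 \<Longrightarrow>
      (g' a + g' b)\<^sup>2 \<le> (2 * g' a - g'' a * (b - a)) * (2 * g' b - g'' b * (a - b))"
  shows "convex_on ({0<..} \<times> {0<..}) (\<lambda>(a, b). (g b - g a) * (b - a))"
proof (rule convex_onI)
  fix t :: real and x y :: "real \<times> real"
  assume t: "t > 0" "t < 1" and xy: "x \<in> {0<..} \<times> {0<..}" "y \<in> {0<..} \<times> {0<..}"
  obtain a1 b1 a2 b2 where [simp]: "x = (a1, b1)" "y = (a2, b2)" by (metis surj_pair)
  have pos: "a1 > 0" "b1 > 0" "a2 > 0" "b2 > 0" using xy by auto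
  define u v where "u = a2 - a1" and "v = b2 - b1"
  define a b where "a s = a1 + s * u" and "b s = b1 + s * v" for s
  have ab_pos: "a s > 0" "b s > 0" if "s \<in> {0..1}" for s
  proof -
    have "a s = (1 - s) * a1 + s * a2" "b s = (1 - s) * b1 + s * b2"
      by (simp_all add: a_def b_def u_def v_def algebra_simps)
    moreover have "(1 - s) * a1 + s * a2 > 0" "(1 - s) * b1 + s * b2 > 0"
      using that pos by (cases "s = 0"; simp add: add_nonneg_pos)+
    ultimately show "a s > 0" "b s > 0" by auto
  qed
  define F where "F s = (g (b s) - g (a s)) * (b s - a s)" for s
  define F' where "F' s = (g' (b s) * v - g' (a s) * u) * (b s - a s)
      + (g (b s) - g (a s)) * (v - u)" for s
  define F'' where "F'' s = (g'' (b s) * v\<^sup>2 - g'' (a s) * u\<^sup>2) * (b s - a s)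
      + 2 * (g' (b s) * v - g' (a s) * u) * (v - u)" for s
  have da: "(a has_real_derivative u) (at s)" and db: "(b has_real_derivative v) (at s)" for s
    unfolding a_def b_def by (auto intro!: derivative_eq_intros)
  have "convex_on {0..1} F"
  proof (rule f''_ge0_imp_convex)
    fix s :: real assume s: "s \<in> {0..1}"
    note p = ab_pos[OF s]
    note d = DERIV_chain2[OF g[OF p(1)] da] DERIV_chain2[OF g[OF p(2)] db]
      DERIV_chain2[OF g'[OF p(1)] da] DERIV_chain2[OF g'[OF p(2)] db] da db
    show "(F has_real_derivative F' s) (at s)"
      unfolding F_def[abs_def] F'_def by (auto intro!: derivative_eq_intros d)
    show "(F' has_real_derivative F'' s) (at s)"
      unfolding F'_def[abs_def] F''_def
      by (auto intro!: derivative_eq_intros d simp: power2_eq_square algebra_simps)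
    \<comment> \<open>This is the Hessian in the direction (u, v): \<open>trace\<close> makes its
      first diagonal entry positive and \<open>det\<close> bounds the mixed entry.\<close>
    have "F'' s = (2 * g' (a s) - g'' (a s) * (b s - a s)) * u\<^sup>2
        + 2 * (- (g' (a s) + g' (b s))) * (u * v)
        + (2 * g' (b s) - g'' (b s) * (a s - b s)) * v\<^sup>2"
      by (simp add: F''_def power2_eq_square algebra_simps)
    also have "\<dots> \<ge> 0"
      using trace[OF p] det[OF p] by (intro quadratic_form_nonneg) (simp_all only: power2_minus)
    finally show "F'' s \<ge> 0" .
  qed simp
  then have "F ((1 - t) *\<^sub>R 0 + t *\<^sub>R 1) \<le> (1 - t) * F 0 + t * F 1"
    using t by (intro convex_onD) auto
  then show "(case (1 - t) *\<^sub>R x + t *\<^sub>R y of (a, b) \<Rightarrow> (g b - g a) * (b - a))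
      \<le> (1 - t) * (case x of (a, b) \<Rightarrow> (g b - g a) * (b - a))
        + t * (case y of (a, b) \<Rightarrow> (g b - g a) * (b - a))"
    by (simp add: F_def a_def b_def u_def v_def algebra_simps)
qed (rule convex_quadrant)

lemma convex_on_square_diff:
  "convex_on ({0<..} \<times> {0<..}) (\<lambda>(a, b). (b - a :: real)\<^sup>2)"
proof -
  have "convex_on ({0<..} \<times> {0<..}) (\<lambda>(a, b). (b - a) * (b - a :: real))"
    by (rule convex_on_increment_product[where g' = "\<lambda>_. 1" and g'' = "\<lambda>_. 0"])
      (auto intro!: derivative_eq_intros)
  then show ?thesis by (simp add: power2_eq_square)
qed

text \<open>The density is homogeneous of degree 1, so its Hessian annihilates the radial direction
  and the determinant condition holds with equality.\<close>

lemma convex_on_ln_increment_product: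
  "convex_on ({0<..} \<times> {0<..}) (\<lambda>(a, b). (ln b - ln a) * (b - a :: real))"
proof (rule convex_on_increment_product[where g' = "\<lambda>x. 1 / x" and g'' = "\<lambda>x. - (1 / x\<^sup>2)"])
  fix a b :: real assume ab: "a > 0" "b > 0"
  have *: "2 * (1 / a) - - (1 / a\<^sup>2) * (b - a) = (a + b) / a\<^sup>2" if "a > 0" for a b :: real
    using that by (simp add: field_simps power2_eq_square)
  show "2 * (1 / a) - - (1 / a\<^sup>2) * (b - a) > 0" unfolding *[OF ab(1)] using ab by simp
  show "(1 / a + 1 / b)\<^sup>2
      \<le> (2 * (1 / a) - - (1 / a\<^sup>2) * (b - a)) * (2 * (1 / b) - - (1 / b\<^sup>2) * (a - b))"
    unfolding *[OF ab(1)] *[OF ab(2)] using ab by (simp add: field_simps power2_eq_square)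
qed (auto intro!: derivative_eq_intros simp: power2_eq_square field_simps)


section \<open>Power densities\<close>

lemma cosh_minus_one: "cosh s - 1 = 2 * (sinh (s / 2))\<^sup>2" for s :: real
  using cosh_double[of "s / 2"] by (simp add: cosh_square_eq)

text \<open>By the half-angle formula this is the square of sinh (\<theta> * s / 2) \<le> \<theta> *
  sinh (s / 2) for s \<ge> 0, which holds because sinh is convex there and vanishes at 0.\<close>

lemma cosh_mult_le:
  fixes s \<theta> :: real
  assumes "0 \<le> \<theta>" "\<theta> \<le> 1"
  shows "cosh (\<theta> * s) - 1 \<le> \<theta>\<^sup>2 * (cosh s - 1)"
proof -
  have "convex_on {0..} (sinh :: real \<Rightarrow> real)"
    by (rule f''_ge0_imp_convex[where f' = cosh and f'' = sinh])
      (auto intro!: derivative_eq_intros)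
  from convex_onD[OF this, of \<theta> 0 "\<bar>s\<bar> / 2"]
  have "sinh (\<theta> * \<bar>s\<bar> / 2) \<le> \<theta> * sinh (\<bar>s\<bar> / 2)" using assms by simp
  then have "2 * (sinh (\<theta> * \<bar>s\<bar> / 2))\<^sup>2 \<le> 2 * (\<theta> * sinh (\<bar>s\<bar> / 2))\<^sup>2"
    using assms by (intro mult_left_mono power_mono) auto
  then have "cosh (\<theta> * \<bar>s\<bar>) - 1 \<le> \<theta>\<^sup>2 * (cosh \<bar>s\<bar> - 1)"
    unfolding cosh_minus_one by (simp add: power_mult_distrib)
  then show ?thesis by (cases "s \<ge> 0") auto
qed

text \<open>With a = exp x and b = exp y the determinant condition depends on s = y - x alone. It
  reads cosh ((1 - p) * s) - 1 \<le> (1 - p^2) * (cosh s - 1), and follows from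
  \<open>cosh_mult_le\<close> because (1 - p)^2 \<le> 1 - p^2.\<close>

lemma convex_on_powr_increment_product:
  fixes p :: real
  assumes p: "0 < p" "p \<le> 1"
  shows "convex_on ({0<..} \<times> {0<..}) (\<lambda>(a, b). (b powr p - a powr p) * (b - a))"
proof (rule convex_on_increment_product[where g' = "\<lambda>x. p * x powr (p - 1)"
      and g'' = "\<lambda>x. p * ((p - 1) * x powr (p - 2))"])
  show "((\<lambda>x. x powr p) has_real_derivative p * x powr (p - 1)) (at x)" if "x > 0" for x
    using that by (auto intro!: derivative_eq_intros)
  show "((\<lambda>x. p * x powr (p - 1)) has_real_derivative p * ((p - 1) * x powr (p - 2))) (at x)"
    if "x > 0" for x
    using that by (auto intro!: derivative_eq_intros)
next
  have *: "2 * (p * a powr (p - 1)) - p * ((p - 1) * a powr (p - 2)) * (b - a)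
      = p * a powr (p - 2) * ((1 + p) * a + (1 - p) * b)" if "a > 0" for a b
  proof -
    have "a powr (p - 1) = a powr (p - 2) * a"
      using that by (simp add: powr_diff power2_eq_square)
    then show ?thesis using that by (simp add: algebra_simps)
  qed
  fix a b :: real assume ab: "a > 0" "b > 0"
  show "2 * (p * a powr (p - 1)) - p * ((p - 1) * a powr (p - 2)) * (b - a) > 0"
    unfolding *[OF ab(1)] using ab p by (intro mult_pos_pos add_pos_nonneg) auto
  define x y where "x = ln a" and "y = ln b"
  have [simp]: "a = exp x" "b = exp y" using ab by (simp_all add: x_def y_def)
  define s where "s = y - x"
  have "(p * a powr (p - 1) + p * b powr (p - 1))\<^sup>2
      = p\<^sup>2 * exp ((p - 1) * (x + y)) * (2 + 2 * cosh ((1 - p) * s))"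
    by (simp add: powr_def cosh_def s_def power2_eq_square algebra_simps flip: exp_add)
  also have "\<dots> \<le> p\<^sup>2 * exp ((p - 1) * (x + y)) * (2 + 2 * p\<^sup>2 + 2 * (1 - p\<^sup>2) * cosh s)"
  proof (intro mult_left_mono)
    have "cosh ((1 - p) * s) - 1 \<le> (1 - p)\<^sup>2 * (cosh s - 1)"
      using p by (intro cosh_mult_le) auto
    also have "\<dots> \<le> (1 - p\<^sup>2) * (cosh s - 1)"
    proof (intro mult_right_mono)
      have "(1 - p\<^sup>2) - (1 - p)\<^sup>2 = 2 * p * (1 - p)" by (simp add: power2_eq_square algebra_simps)
      also have "\<dots> \<ge> 0" using p by simp
      finally show "(1 - p)\<^sup>2 \<le> 1 - p\<^sup>2" by simp
    qed (simp add: cosh_real_ge_1)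
    finally show "2 + 2 * cosh ((1 - p) * s) \<le> 2 + 2 * p\<^sup>2 + 2 * (1 - p\<^sup>2) * cosh s"
      by (simp add: algebra_simps)
  qed auto
  also have "\<dots> = p\<^sup>2 * exp ((p - 2) * (x + y))
      * (((1 + p) * exp x + (1 - p) * exp y) * ((1 + p) * exp y + (1 - p) * exp x))"
    by (simp add: cosh_def s_def power2_eq_square algebra_simps flip: exp_add)
  also have "\<dots> = (p * a powr (p - 2) * ((1 + p) * a + (1 - p) * b))
      * (p * b powr (p - 2) * ((1 + p) * b + (1 - p) * a))"
    by (simp add: powr_def power2_eq_square algebra_simps flip: exp_add)
  also note *[OF ab(1), of b, symmetric]
  also note *[OF ab(2), of a, symmetric]
  finally show "(p * a powr (p - 1) + p * b powr (p - 1))\<^sup>2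
      \<le> (2 * (p * a powr (p - 1)) - p * ((p - 1) * a powr (p - 2)) * (b - a))
        * (2 * (p * b powr (p - 1)) - p * ((p - 1) * b powr (p - 2)) * (a - b))" .
qed


section \<open>Transfer of convexity to densities known only at positive arguments\<close>

lemma convex_on_congI:
  assumes f: "convex_on C f" and eq: "\<forall>z\<in>C. f z = g z"
  shows "convex_on C g"
proof (rule convex_onI)
  fix t :: real and x y assume *: "0 < t" "t < 1" "x \<in> C" "y \<in> C"
  have "(1 - t) *\<^sub>R x + t *\<^sub>R y \<in> C"
    using convex_on_imp_convex[OF f] * by (intro convexD) auto
  then show "g ((1 - t) *\<^sub>R x + t *\<^sub>R y) \<le> (1 - t) * g x + t * g y"
    using convex_onD[OF f, of t x y] * eq by auto
qed (rule convex_on_imp_convex[OF f])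

lemma convex_on_scale:
  fixes \<Psi> \<Psi>' :: "real \<Rightarrow> real \<Rightarrow> real"
  assumes conv: "convex_on ({0<..} \<times> {0<..}) (\<lambda>(a, b). \<Psi>' a b)"
    and eq: "\<And>a b. a > 0 \<Longrightarrow> b > 0 \<Longrightarrow> \<Psi> a b = s * \<Psi>' a b" and "s \<ge> 0"
  shows "convex_on ({0<..} \<times> {0<..}) (\<lambda>(a, b). \<Psi> a b)"
proof -
  have "convex_on ({0<..} \<times> {0<..}) (\<lambda>z. s * (\<lambda>(a, b). \<Psi>' a b) z)"
    using conv \<open>s \<ge> 0\<close> by (intro convex_on_cmul)
  moreover have "\<forall>z \<in> {0<..} \<times> {0<..}. s * (\<lambda>(a, b). \<Psi>' a b) z = (\<lambda>(a, b). \<Psi> a b) z"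
    by (auto simp: eq)
  ultimately show ?thesis by (rule convex_on_congI)
qed

section \<open>Contraction of the energy densities under merging\<close>

text \<open>Coupled chains at two neighbouring states with function values \<open>a\<close> and \<open>b\<close> merge into the
  second state at rate \<open>A\<close> and into the first at rate \<open>B\<close>.\<close>
definition merge_contracts :: "(real \<Rightarrow> real \<Rightarrow> real) \<Rightarrow> real \<Rightarrow> real \<Rightarrow> real \<Rightarrow> bool" where
  "merge_contracts \<Psi> l k k' \<longleftrightarrow> (\<forall>A B t a b. a > 0 \<longrightarrow> b > 0 \<longrightarrow> t \<ge> 0 \<longrightarrow> A \<ge> l \<longrightarrow> B \<ge> l \<longrightarrow>
     A + B \<ge> k \<longrightarrow> t * (A + B) \<le> 1 \<longrightarrow>
     \<Psi> (a + t * A * (b - a)) (b - t * B * (b - a)) \<le> (1 - t * k) * (1 - t * k') * \<Psi> a b)"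

lemma merged_pos:
  fixes a b t A B :: real
  assumes ab: "a > 0" "b > 0" and "t \<ge> 0" "A \<ge> 0" "B \<ge> 0" "t * (A + B) \<le> 1"
  shows "a + t * A * (b - a) > 0" "b - t * B * (b - a) > 0"
proof -
  have AB: "0 \<le> t * A" "0 \<le> t * B" using assms by auto
  then have le: "t * A \<le> 1" "t * B \<le> 1" using assms(6) by (auto simp: distrib_left)
  have "a + t * A * (b - a) = (1 - t * A) * a + t * A * b" by (simp add: algebra_simps)
  also have "\<dots> > 0" using ab AB le by (cases "t * A = 1") (auto intro: add_pos_nonneg)
  finally show "a + t * A * (b - a) > 0" .
  have "b - t * B * (b - a) = (1 - t * B) * b + t * B * a" by (simp add: algebra_simps)
  also have "\<dots> > 0" using ab AB le by (cases "t * B = 1") (auto intro: add_pos_nonneg)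
  finally show "b - t * B * (b - a) > 0" .
qed

lemma merge_contracts_scale:
  assumes \<Psi>: "merge_contracts \<Psi>' l k k'" and eq: "\<And>a b. a > 0 \<Longrightarrow> b > 0 \<Longrightarrow> \<Psi> a b = s * \<Psi>' a b"
    and "s \<ge> 0" "l \<ge> 0"
  shows "merge_contracts \<Psi> l k k'"
  unfolding merge_contracts_def
proof (intro allI impI)
  fix A B t a b :: real
  assume *: "a > 0" "b > 0" "t \<ge> 0" "A \<ge> l" "B \<ge> l" "A + B \<ge> k" "t * (A + B) \<le> 1"
  have pos: "a + t * A * (b - a) > 0" "b - t * B * (b - a) > 0"
    using merged_pos[of a b t A B] * \<open>l \<ge> 0\<close> by auto
  have "s * \<Psi>' (a + t * A * (b - a)) (b - t * B * (b - a)) \<le> s * ((1 - t * k) * (1 - t * k') * \<Psi>' a b)"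
    using \<Psi> * \<open>s \<ge> 0\<close> unfolding merge_contracts_def by (intro mult_left_mono) auto
  then show "\<Psi> (a + t * A * (b - a)) (b - t * B * (b - a)) \<le> (1 - t * k) * (1 - t * k') * \<Psi> a b"
    using * pos by (simp add: eq mult_ac)
qed

text \<open>Exchanging a and b exchanges A and B, and the bound treats the two rates alike; so a
  \<le> b may be assumed.\<close>

lemma merge_contracts_symI:
  assumes sym: "\<And>a b. \<Psi> a b = \<Psi> b a"
    and le: "\<And>A B t a b. 0 < a \<Longrightarrow> a \<le> b \<Longrightarrow> t \<ge> 0 \<Longrightarrow> A \<ge> l \<Longrightarrow> B \<ge> l \<Longrightarrow>
     A + B \<ge> k \<Longrightarrow> t * (A + B) \<le> 1 \<Longrightarrow>
     \<Psi> (a + t * A * (b - a)) (b - t * B * (b - a)) \<le> (1 - t * k) * (1 - t * k') * \<Psi> a b"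
  shows "merge_contracts \<Psi> l k k'"
  unfolding merge_contracts_def
proof (intro allI impI)
  fix A B t a b :: real
  assume *: "a > 0" "b > 0" "t \<ge> 0" "A \<ge> l" "B \<ge> l" "A + B \<ge> k" "t * (A + B) \<le> 1"
  show "\<Psi> (a + t * A * (b - a)) (b - t * B * (b - a)) \<le> (1 - t * k) * (1 - t * k') * \<Psi> a b"
  proof (cases "a \<le> b")
    case True
    then show ?thesis using * by (intro le)
  next
    case False
    then have "\<Psi> (b + t * B * (a - b)) (a - t * A * (a - b)) \<le> (1 - t * k) * (1 - t * k') * \<Psi> b a"
      using * by (intro le) (auto simp: add.commute)
    moreover have "b + t * B * (a - b) = b - t * B * (b - a)" "a - t * A * (a - b) = a + t * A * (b - a)"
      by (simp_all add: algebra_simps)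
    ultimately show ?thesis by (simp only: sym[of "b - _"] sym[of b a])
  qed
qed

text \<open>The merged pair is an average of (b, b), (a, a) and (a, b). The first two lie on the
  diagonal, where the density vanishes, so Jensen leaves only the weight 1 - t * (A + B) of the
  third.\<close>

lemma merge_contracts_convex:
  assumes conv: "convex_on ({0<..} \<times> {0<..}) (\<lambda>(a, b). \<Psi> a b)"
    and nonneg: "\<And>a b. a > 0 \<Longrightarrow> b > 0 \<Longrightarrow> \<Psi> a b \<ge> 0" and diag: "\<And>a. \<Psi> a a = 0" and "l \<ge> 0"
  shows "merge_contracts \<Psi> l k 0"
  unfolding merge_contracts_def
proof (intro allI impI)
  fix A B t a b :: real
  assume ab: "a > 0" "b > 0" and t: "t \<ge> 0" and AB: "A \<ge> l" "B \<ge> l" "A + B \<ge> k" "t * (A + B) \<le> 1"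
  let ?w = "\<lambda>j. if j then t * A else t * B" and ?p = "\<lambda>j. if j then (b, b) else (a, a)"
  have w: "sum ?w UNIV = t * (A + B)" by (simp add: UNIV_bool algebra_simps)
  have "(\<lambda>(a, b). \<Psi> a b) ((a, b) + (\<Sum>j\<in>UNIV. ?w j *\<^sub>R (?p j - (a, b))))
      \<le> (\<Sum>j\<in>UNIV. ?w j * (\<lambda>(a, b). \<Psi> a b) (?p j)) + (1 - sum ?w UNIV) * (\<lambda>(a, b). \<Psi> a b) (a, b)"
    using t AB ab \<open>l \<ge> 0\<close> unfolding w[symmetric] by (intro convex_on_sum_base[OF conv]) auto
  then have "\<Psi> (a + t * A * (b - a)) (b - t * B * (b - a)) \<le> (1 - t * (A + B)) * \<Psi> a b"
    unfolding w by (simp add: UNIV_bool diag algebra_simps)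
  also have "\<dots> \<le> (1 - t * k) * \<Psi> a b"
    using AB t nonneg[OF ab] by (intro mult_right_mono) (auto intro: mult_left_mono)
  finally show "\<Psi> (a + t * A * (b - a)) (b - t * B * (b - a)) \<le> (1 - t * k) * (1 - t * 0) * \<Psi> a b"
    by simp
qed

text \<open>As a function of s the left side is convex on [0, 1/2] and vanishes at 1/2, where both
  arguments reach the midpoint. The right side is its chord.\<close>

lemma ln_ratio_le:
  fixes a b s :: real
  assumes ab: "0 < a" "a \<le> b" and s: "0 \<le> s" "s \<le> 1 / 2"
  shows "ln (b - s * (b - a)) - ln (a + s * (b - a)) \<le> (1 - 2 * s) * (ln b - ln a)"
proof -
  define d where "d = b - a"
  define g where "g r = ln (b - r * d) - ln (a + r * d)" for r
  have "convex_on {0..1 / 2} g"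
  proof (rule f''_ge0_imp_convex)
    fix r :: real assume r: "r \<in> {0..1 / 2}"
    have "r * d \<le> 1 / 2 * d" using r ab by (intro mult_right_mono) (auto simp: d_def)
    moreover have "r * d \<ge> 0" using r ab by (simp add: d_def)
    ultimately have p: "a + r * d > 0" "b - r * d > 0" and q: "a + r * d \<le> b - r * d"
      using ab d_def by linarith+
    show "(g has_real_derivative (- d / (b - r * d) - d / (a + r * d))) (at r)"
      unfolding g_def[abs_def] using p
      by (auto intro!: derivative_eq_intros simp del: diff_gt_0_iff_gt)
    show "((\<lambda>r. - d / (b - r * d) - d / (a + r * d)) has_real_derivative
        (d\<^sup>2 / (a + r * d)\<^sup>2 - d\<^sup>2 / (b - r * d)\<^sup>2)) (at r)"
      by (rule derivative_eq_intros refl p[THEN less_imp_neq, symmetric])+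
        (simp add: power2_eq_square)
    have "d\<^sup>2 / (b - r * d)\<^sup>2 \<le> d\<^sup>2 / (a + r * d)\<^sup>2"
      by (intro divide_left_mono power_mono mult_pos_pos zero_less_power)
        (use p q in \<open>linarith | simp\<close>)+
    then show "0 \<le> d\<^sup>2 / (a + r * d)\<^sup>2 - d\<^sup>2 / (b - r * d)\<^sup>2" by simp
  qed simp
  from convex_onD[OF this, of "2 * s" 0 "1 / 2"] s
  have "g s \<le> (1 - 2 * s) * g 0 + 2 * s * g (1 / 2)" by simp
  moreover have "g (1 / 2) = 0" by (simp add: g_def d_def field_simps)
  ultimately show ?thesis by (simp add: g_def d_def)
qed

text \<open>Merging at equal rates into both states moves \<open>a\<close> and \<open>b\<close> towards each other, and then both
  factors of the density contract.\<close>
lemma merge_contracts_ln: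
  assumes l: "l \<ge> 0"
  shows "merge_contracts (\<lambda>a b. (ln b - ln a) * (b - a)) l k (2 * l)"
proof (rule merge_contracts_symI)
  fix A B t a b :: real
  assume ab: "0 < a" "a \<le> b" and t: "t \<ge> 0" and AB: "A \<ge> l" "B \<ge> l" "A + B \<ge> k" "t * (A + B) \<le> 1"
  define d where "d = b - a"
  have d: "d \<ge> 0" using ab by (simp add: d_def)
  have tl: "t * l \<le> t * A" "t * l \<le> t * B" "t * k \<le> t * (A + B)"
    using t AB by (auto intro: mult_left_mono)
  have tl0: "0 \<le> t * l" using t l by simp
  have s: "t * l \<le> 1 / 2" "t * B \<le> 1" using tl tl0 AB(4) by (auto simp: distrib_left)
  have L: "ln b - ln a \<ge> 0" using ab by simp
  \<comment> \<open>Lowering both rates to \<open>l\<close> raises the larger argument and lowers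
    the smaller one; after that the rates are equal, as \<open>ln_ratio_le\<close> requires.\<close>
  have "ln (b - t * B * d) - ln (a + t * A * d) \<le> ln (b - t * l * d) - ln (a + t * l * d)"
  proof (intro diff_mono)
    have "t * B * d \<le> 1 * d" using s d by (intro mult_right_mono)
    then have "b - t * B * d > 0" using ab by (simp add: d_def)
    moreover have "b - t * B * d \<le> b - t * l * d" using tl d by (simp add: mult_right_mono)
    ultimately show "ln (b - t * B * d) \<le> ln (b - t * l * d)" by simp
    have "a + t * l * d > 0" using ab tl0 d by (intro add_pos_nonneg) auto
    moreover have "a + t * l * d \<le> a + t * A * d" using tl d by (simp add: mult_right_mono)
    ultimately show "ln (a + t * l * d) \<le> ln (a + t * A * d)" by simp
  qed
  also have "\<dots> \<le> (1 - 2 * (t * l)) * (ln b - ln a)"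
    unfolding d_def using ab tl0 s by (intro ln_ratio_le) auto
  finally have "(ln (b - t * B * d) - ln (a + t * A * d)) * ((1 - t * (A + B)) * d)
      \<le> (1 - 2 * (t * l)) * (ln b - ln a) * ((1 - t * (A + B)) * d)"
    using AB d by (intro mult_right_mono) auto
  also have "\<dots> \<le> (1 - 2 * (t * l)) * (ln b - ln a) * ((1 - t * k) * d)"
    using tl s L d by (intro mult_left_mono mult_right_mono mult_nonneg_nonneg) auto
  finally show "(ln (b - t * B * (b - a)) - ln (a + t * A * (b - a)))
      * (b - t * B * (b - a) - (a + t * A * (b - a)))
      \<le> (1 - t * k) * (1 - t * (2 * l)) * ((ln b - ln a) * (b - a))"
    by (simp add: d_def algebra_simps)
qed (simp add: algebra_simps)

text \<open>For p \<le> 1 the power is concave, so its increments shrink under translation to the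
  right.\<close>

lemma powr_diff_shift_le:
  fixes x y e p :: real
  assumes "0 < x" "x \<le> y" "e \<ge> 0" "0 < p" "p \<le> 1"
  shows "(y + e) powr p - (x + e) powr p \<le> y powr p - x powr p"
proof -
  have "\<exists>z. ((\<lambda>e. (y + e) powr p - (x + e) powr p) has_real_derivative z) (at r) \<and> z \<le> 0"
    if "0 \<le> r" "r \<le> e" for r
  proof (intro exI conjI)
    show "((\<lambda>e. (y + e) powr p - (x + e) powr p) has_real_derivative
        p * (y + r) powr (p - 1) - p * (x + r) powr (p - 1)) (at r)"
      using assms that by (auto intro!: derivative_eq_intros)
    show "p * (y + r) powr (p - 1) - p * (x + r) powr (p - 1) \<le> 0"
      using assms that by (auto intro!: mult_left_mono powr_mono2')
  qed
  from DERIV_nonpos_imp_nonincreasing[OF assms(3) this] show ?thesis by simp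
qed

text \<open>Bernoulli's inequality, obtained from convexity of exp between 0 and ln z.\<close>

lemma powr_le_tangent:
  fixes z p :: real
  assumes "0 < z" "0 \<le> p" "p \<le> 1"
  shows "z powr p \<le> 1 - p * (1 - z)"
proof -
  have "exp ((1 - p) *\<^sub>R 0 + p *\<^sub>R ln z) \<le> (1 - p) * exp 0 + p * exp (ln z)"
    using assms by (intro convex_onD[OF exp_convex]) auto
  then show ?thesis using assms by (simp add: powr_def algebra_simps)
qed

text \<open>The density is homogeneous of degree \<open>p + 1\<close> and decreasing under simultaneous translation
  of both arguments; merging is a scaling followed by such a translation.\<close>
lemma merge_contracts_powr:
  assumes p: "0 < p" "p \<le> 1" and "l \<ge> 0" "k \<ge> 0"
  shows "merge_contracts (\<lambda>a b. (b powr p - a powr p) * (b - a)) l k (p * k)"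
proof (rule merge_contracts_symI)
  fix A B t a b :: real
  assume ab: "0 < a" "a \<le> b" and t: "t \<ge> 0" and AB: "A \<ge> l" "B \<ge> l" "A + B \<ge> k" "t * (A + B) \<le> 1"
  define z where "z = 1 - t * (A + B)"
  define e where "e = t * (A * b + B * a)"
  have AB0: "A \<ge> 0" "B \<ge> 0" using AB \<open>l \<ge> 0\<close> by auto
  have z: "0 \<le> z" "z \<le> 1 - t * k" using AB t by (auto simp: z_def intro: mult_left_mono)
  have e: "e \<ge> 0" using AB0 t ab by (simp add: e_def)
  have D: "b powr p - a powr p \<ge> 0" using ab p by (simp add: powr_mono2)
  have eq: "b - t * B * (b - a) = z * b + e" "a + t * A * (b - a) = z * a + e"
    by (simp_all add: z_def e_def algebra_simps)
  have "((z * b + e) powr p - (z * a + e) powr p) * (z * (b - a))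
      \<le> ((1 - t * (p * k)) * (b powr p - a powr p)) * ((1 - t * k) * (b - a))"
  proof (cases "z = 0")
    \<comment> \<open>The pair has merged completely and the left side is 0; the power estimates,
      which need positive scaled arguments, are kept for the other case.\<close>
    case True
    have "p * (t * k) \<le> 1 * (t * k)" using p t \<open>k \<ge> 0\<close> by (intro mult_right_mono) auto
    then show ?thesis using True z D ab by (simp add: mult_ac)
  next
    case False
    then have z0: "z > 0" using z by simp
    have "(z * b + e) powr p - (z * a + e) powr p \<le> (z * b) powr p - (z * a) powr p"
      using z0 ab e p by (intro powr_diff_shift_le) auto
    also have "\<dots> = z powr p * (b powr p - a powr p)"
      using z0 ab by (simp add: powr_mult algebra_simps)
    also have "\<dots> \<le> (1 - t * (p * k)) * (b powr p - a powr p)"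
    proof (intro mult_right_mono D)
      have "z powr p \<le> 1 - p * (1 - z)" using z0 p by (intro powr_le_tangent) auto
      also have "\<dots> \<le> 1 - p * (t * k)" using z p by (auto intro: mult_left_mono)
      finally show "z powr p \<le> 1 - t * (p * k)" by (simp add: mult_ac)
    qed
    finally have 1: "(z * b + e) powr p - (z * a + e) powr p \<le> (1 - t * (p * k)) * (b powr p - a powr p)" .
    have "(z * a + e) powr p \<le> (z * b + e) powr p"
      using z0 ab e p by (intro powr_mono2) auto
    moreover have "z * (b - a) \<le> (1 - t * k) * (b - a)" using z ab by (intro mult_right_mono) auto
    ultimately show ?thesis using 1 z ab by (intro mult_mono) auto
  qed
  also have "z * (b - a) = (z * b + e) - (z * a + e)" by (simp add: algebra_simps)
  finally show "((b - t * B * (b - a)) powr p - (a + t * A * (b - a)) powr p)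
      * (b - t * B * (b - a) - (a + t * A * (b - a)))
      \<le> (1 - t * k) * (1 - t * (p * k)) * ((b powr p - a powr p) * (b - a))"
    unfolding eq by (simp add: mult_ac)
qed (simp add: algebra_simps)

section \<open>Entropy bounds from a one-step contraction\<close>

locale involutive_chain =
  fixes S :: "'s set" and I :: "'i set" and T :: "'i \<Rightarrow> 's \<Rightarrow> 's"
    and c :: "'s \<Rightarrow> 'i \<Rightarrow> real" and \<mu> :: "'s \<Rightarrow> real"
  assumes finite_S: "finite S" and finite_I: "finite I"
    and T_in: "i \<in> I \<Longrightarrow> x \<in> S \<Longrightarrow> T i x \<in> S"
    and T_T: "i \<in> I \<Longrightarrow> x \<in> S \<Longrightarrow> T i (T i x) = x"
    and c_pos: "i \<in> I \<Longrightarrow> x \<in> S \<Longrightarrow> c x i > 0"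
    and \<mu>_pos: "x \<in> S \<Longrightarrow> \<mu> x > 0"
    and \<mu>_sum: "sum \<mu> S = 1"
    and reversible: "i \<in> I \<Longrightarrow> x \<in> S \<Longrightarrow> \<mu> (T i x) * c (T i x) i = \<mu> x * c x i"
    and connected: "x \<in> S \<Longrightarrow> y \<in> S \<Longrightarrow> (\<lambda>x y. x \<in> S \<and> (\<exists>i\<in>I. y = T i x))\<^sup>*\<^sup>* x y"
begin

definition step :: "real \<Rightarrow> ('s \<Rightarrow> real) \<Rightarrow> 's \<Rightarrow> real" where
  "step h f x = f x + h * (\<Sum>i\<in>I. c x i * (f (T i x) - f x))"

text \<open>The density is a parameter because both \<open>Phi\<close> and the squared difference
  are inserted.\<close>

definition energy :: "(real \<Rightarrow> real \<Rightarrow> real) \<Rightarrow> ('s \<Rightarrow> real) \<Rightarrow> real" where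
  "energy \<Psi> f = 1 / 2 * (\<Sum>x\<in>S. \<Sum>i\<in>I. c x i * \<Psi> (f x) (f (T i x)) * \<mu> x)"

lemma sum_T: "i \<in> I \<Longrightarrow> (\<Sum>x\<in>S. g (T i x)) = (\<Sum>x\<in>S. g x)"
  by (rule sum.reindex_bij_witness[of _ "T i" "T i"]) (auto simp: T_in T_T)

text \<open>Summation by parts: averaging over the two ends of an edge, which have equal weight by
  reversibility, replaces \<open>g x\<close> by minus half the increment of
  \<open>g\<close>.\<close>

lemma dirichlet_form:
  "(\<Sum>x\<in>S. \<mu> x * g x * (\<Sum>i\<in>I. c x i * (f (T i x) - f x)))
     = - (1 / 2) * (\<Sum>x\<in>S. \<Sum>i\<in>I. c x i * ((g (T i x) - g x) * (f (T i x) - f x)) * \<mu> x)"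
proof -
  define A where "A i x = \<mu> x * c x i * (g x * (f (T i x) - f x))" for i x
  define B where "B i x = \<mu> x * c x i * ((g (T i x) - g x) * (f (T i x) - f x))" for i x
  have "sum (A i) S = - (1 / 2) * sum (B i) S" if i: "i \<in> I" for i
  proof -
    have "A i x + A i (T i x) = - B i x" if "x \<in> S" for x
    proof -
      have "A i (T i x) = \<mu> x * c x i * (g (T i x) * (f x - f (T i x)))"
        using reversible[OF i that] T_T[OF i that] by (simp add: A_def)
      then show ?thesis by (simp add: A_def B_def algebra_simps)
    qed
    then have "(\<Sum>x\<in>S. A i x + A i (T i x)) = - sum (B i) S" by (simp add: sum_negf)
    then show ?thesis using sum_T[OF i, of "A i"] by (simp add: sum.distrib)
  qed
  then have "(\<Sum>i\<in>I. sum (A i) S) = - (1 / 2) * (\<Sum>i\<in>I. sum (B i) S)"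
    by (simp add: sum_distrib_left)
  moreover have "(\<Sum>x\<in>S. \<mu> x * g x * (\<Sum>i\<in>I. c x i * (f (T i x) - f x))) = (\<Sum>i\<in>I. sum (A i) S)"
    by (subst sum.swap) (simp add: A_def sum_distrib_left algebra_simps)
  moreover have "(\<Sum>x\<in>S. \<Sum>i\<in>I. c x i * ((g (T i x) - g x) * (f (T i x) - f x)) * \<mu> x)
      = (\<Sum>i\<in>I. sum (B i) S)"
    by (subst (2) sum.swap) (simp add: B_def algebra_simps)
  ultimately show ?thesis by simp
qed

lemma mean_step: "(\<Sum>x\<in>S. step h f x * \<mu> x) = (\<Sum>x\<in>S. f x * \<mu> x)"
proof -
  have "(\<Sum>x\<in>S. step h f x * \<mu> x)
      = (\<Sum>x\<in>S. f x * \<mu> x) + h * (\<Sum>x\<in>S. \<mu> x * 1 * (\<Sum>i\<in>I. c x i * (f (T i x) - f x)))"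
    by (simp add: step_def distrib_right sum.distrib sum_distrib_left algebra_simps)
  then show ?thesis unfolding dirichlet_form[where g = "\<lambda>_. 1"] by simp
qed

text \<open>The step is an average in which the value at \<open>x\<close> keeps a positive weight, 1
  minus \<open>h\<close> times the total jump rate.\<close>

lemma step_pos:
  assumes f: "\<forall>x\<in>S. f x > 0" and "h \<ge> 0" and h: "\<forall>x\<in>S. h * (\<Sum>i\<in>I. c x i) < 1" and x: "x \<in> S"
  shows "step h f x > 0"
proof -
  have "step h f x = (1 - h * (\<Sum>i\<in>I. c x i)) * f x + h * (\<Sum>i\<in>I. c x i * f (T i x))"
    by (simp add: step_def right_diff_distrib sum_subtractf sum_distrib_left sum_distrib_right
        left_diff_distrib mult_ac)
  moreover have "(1 - h * (\<Sum>i\<in>I. c x i)) * f x > 0" using f h x by simp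
  moreover have "h * (\<Sum>i\<in>I. c x i * f (T i x)) \<ge> 0"
    using f x \<open>h \<ge> 0\<close> by (intro mult_nonneg_nonneg sum_nonneg) (auto simp: T_in c_pos less_imp_le)
  ultimately show ?thesis by simp
qed

lemma iterate_pos:
  assumes "\<forall>x\<in>S. f x > 0" "h \<ge> 0" "\<forall>x\<in>S. h * (\<Sum>i\<in>I. c x i) < 1"
  shows "\<forall>x\<in>S. (step h ^^ n) f x > 0"
  using assms by (induction n) (auto intro!: step_pos)

lemma mean_iterate: "(\<Sum>x\<in>S. (step h ^^ n) f x * \<mu> x) = (\<Sum>x\<in>S. f x * \<mu> x)"
  by (induction n) (auto simp: mean_step)

lemma mean_pos: "\<forall>x\<in>S. f x > 0 \<Longrightarrow> (\<Sum>x\<in>S. f x * \<mu> x) > 0"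
proof -
  assume f: "\<forall>x\<in>S. f x > 0"
  have "S \<noteq> {}" using \<mu>_sum by auto
  then show ?thesis using f finite_S by (intro sum_pos) (auto simp: \<mu>_pos)
qed

text \<open>Convexity makes the explicit Euler step dissipate no more entropy than the energy
  allows, so no second-order error term appears.\<close>
lemma entropy_step:
  assumes tangent: "\<And>a b. a > 0 \<Longrightarrow> b > 0 \<Longrightarrow> \<phi> b \<ge> \<phi> a + deriv \<phi> a * (b - a)"
    and f: "\<forall>x\<in>S. f x > 0" and h: "h \<ge> 0" "\<forall>x\<in>S. h * (\<Sum>i\<in>I. c x i) < 1"
  shows "phi_entropy S \<mu> \<phi> f - phi_entropy S \<mu> \<phi> (step h f) \<le> h * energy (Phi \<phi>) f"
proof -
  have "(\<Sum>x\<in>S. \<phi> (step h f x) * \<mu> x)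
      \<ge> (\<Sum>x\<in>S. (\<phi> (f x) + deriv \<phi> (f x) * (step h f x - f x)) * \<mu> x)"
    by (intro sum_mono mult_right_mono tangent) (auto simp: f step_pos[OF f h] \<mu>_pos less_imp_le)
  moreover have "(\<Sum>x\<in>S. (\<phi> (f x) + deriv \<phi> (f x) * (step h f x - f x)) * \<mu> x)
     = (\<Sum>x\<in>S. \<phi> (f x) * \<mu> x)
       + h * (\<Sum>x\<in>S. \<mu> x * deriv \<phi> (f x) * (\<Sum>i\<in>I. c x i * (f (T i x) - f x)))"
    by (simp add: step_def distrib_right sum.distrib sum_distrib_left algebra_simps)
  moreover have "(\<Sum>x\<in>S. \<mu> x * deriv \<phi> (f x) * (\<Sum>i\<in>I. c x i * (f (T i x) - f x)))
      = - energy (Phi \<phi>) f"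
    using dirichlet_form[of "\<lambda>x. deriv \<phi> (f x)" f] by (simp add: energy_def Phi_def)
  ultimately show ?thesis by (simp add: phi_entropy_def mean_step)
qed

lemma energy_nonneg:
  assumes "\<And>a b. a > 0 \<Longrightarrow> b > 0 \<Longrightarrow> \<Psi> a b \<ge> 0" "\<forall>x\<in>S. f x > 0"
  shows "energy \<Psi> f \<ge> 0"
  unfolding energy_def using assms
  by (intro mult_nonneg_nonneg sum_nonneg) (auto simp: T_in c_pos \<mu>_pos less_imp_le)

text \<open>Geometric decay of the quadratic energy sends the difference along each edge to 0,
  connectedness extends this to all pairs of states, and conservation of the mean identifies the
  limit.\<close>

lemma iterate_tendsto_mean:
  assumes f: "\<forall>x\<in>S. f x > 0" and h: "h \<ge> 0" "\<forall>x\<in>S. h * (\<Sum>i\<in>I. c x i) < 1"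
    and \<rho>: "0 \<le> \<rho>" "\<rho> < 1"
    and contr: "\<And>g. \<forall>x\<in>S. g x > 0 \<Longrightarrow>
      energy (\<lambda>a b. (b - a)\<^sup>2) (step h g) \<le> \<rho> * energy (\<lambda>a b. (b - a)\<^sup>2) g"
    and x: "x \<in> S"
  shows "(\<lambda>n. (step h ^^ n) f x) \<longlonglongrightarrow> (\<Sum>y\<in>S. f y * \<mu> y)"
proof -
  let ?E = "energy (\<lambda>a b. (b - a)\<^sup>2)"
  define F where "F n = (step h ^^ n) f" for n
  have pos: "\<forall>x\<in>S. F n x > 0" for n unfolding F_def by (rule iterate_pos[OF f h])
  have E: "?E (F n) \<le> \<rho> ^ n * ?E f" for n
  proof (induction n)
    case (Suc n)
    have "?E (F (Suc n)) \<le> \<rho> * ?E (F n)" using contr[OF pos[of n]] by (simp add: F_def)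
    also have "\<dots> \<le> \<rho> * (\<rho> ^ n * ?E f)" using Suc \<rho> by (intro mult_left_mono)
    finally show ?case by (simp add: mult.assoc)
  qed (simp add: F_def)
  have edge: "(\<lambda>n. F n (T i z) - F n z) \<longlonglongrightarrow> 0" if z: "z \<in> S" and i: "i \<in> I" for z i
  proof -
    let ?w = "c z i * \<mu> z"
    have w: "?w > 0" using z i by (simp add: c_pos \<mu>_pos)
    have *: "c y j * (F n (T j y) - F n y)\<^sup>2 * \<mu> y \<ge> 0" if "y \<in> S" "j \<in> I" for n y j
      using that by (simp add: c_pos \<mu>_pos less_imp_le)
    have bound: "(F n (T i z) - F n z)\<^sup>2 \<le> \<rho> ^ n * (2 * ?E f / ?w)" for n
    proof -
      have "c z i * (F n (T i z) - F n z)\<^sup>2 * \<mu> z \<le> (\<Sum>i\<in>I. c z i * (F n (T i z) - F n z)\<^sup>2 * \<mu> z)"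
        using i finite_I z by (intro member_le_sum *) auto
      also have "\<dots> \<le> (\<Sum>y\<in>S. \<Sum>i\<in>I. c y i * (F n (T i y) - F n y)\<^sup>2 * \<mu> y)"
        by (rule member_le_sum[OF z _ finite_S]) (auto intro!: sum_nonneg *)
      also have "\<dots> = 2 * ?E (F n)" by (simp add: energy_def)
      also have "\<dots> \<le> 2 * (\<rho> ^ n * ?E f)" using E[of n] by simp
      finally show ?thesis using w by (simp add: field_simps)
    qed
    have "(\<lambda>n. \<rho> ^ n * (2 * ?E f / ?w)) \<longlonglongrightarrow> 0"
      by (rule tendsto_mult_left_zero[OF LIMSEQ_realpow_zero[OF \<rho>]])
    then have "(\<lambda>n. (F n (T i z) - F n z)\<^sup>2) \<longlonglongrightarrow> 0"
      by (rule Lim_null_comparison[rotated]) (use bound in \<open>simp add: always_eventually\<close>)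
    then have "(\<lambda>n. sqrt ((F n (T i z) - F n z)\<^sup>2)) \<longlonglongrightarrow> sqrt 0" by (rule tendsto_real_sqrt)
    then show ?thesis by (simp add: tendsto_rabs_zero_iff)
  qed
  have diff: "(\<lambda>n. F n y - F n x) \<longlonglongrightarrow> 0" if "y \<in> S" for y
    using connected[OF x that]
  proof induction
    case (step y z)
    then obtain i where "i \<in> I" "z = T i y" "y \<in> S" by blast
    then have "(\<lambda>n. (F n z - F n y) + (F n y - F n x)) \<longlonglongrightarrow> 0 + 0"
      using step.IH edge by (intro tendsto_add) auto
    then show ?case by simp
  qed simp
  have "F n x = (\<Sum>y\<in>S. f y * \<mu> y) - (\<Sum>y\<in>S. (F n y - F n x) * \<mu> y)" for n
    using mean_iterate[where n = n and h = h and f = f] \<mu>_sum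
    by (simp add: F_def left_diff_distrib sum_subtractf sum_distrib_left[symmetric])
  moreover have "(\<lambda>n. (\<Sum>y\<in>S. f y * \<mu> y) - (\<Sum>y\<in>S. (F n y - F n x) * \<mu> y))
      \<longlonglongrightarrow> (\<Sum>y\<in>S. f y * \<mu> y) - (\<Sum>y\<in>S. 0 * \<mu> y)"
    by (intro tendsto_diff tendsto_sum tendsto_mult tendsto_const diff)
  ultimately show ?thesis by (simp add: F_def)
qed

lemma entropy_le_energy:
  assumes tangent: "\<And>a b. a > 0 \<Longrightarrow> b > 0 \<Longrightarrow> \<phi> b \<ge> \<phi> a + deriv \<phi> a * (b - a)"
    and cont: "\<And>a. a > 0 \<Longrightarrow> isCont \<phi> a"
    and f: "\<forall>x\<in>S. f x > 0" and h: "h > 0" "\<forall>x\<in>S. h * (\<Sum>i\<in>I. c x i) < 1"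
    and \<rho>: "0 \<le> \<rho>" "\<rho> < 1"
    and contr2: "\<And>g. \<forall>x\<in>S. g x > 0 \<Longrightarrow>
      energy (\<lambda>a b. (b - a)\<^sup>2) (step h g) \<le> \<rho> * energy (\<lambda>a b. (b - a)\<^sup>2) g"
    and k: "k \<ge> 0"
    and contr: "\<And>g. \<forall>x\<in>S. g x > 0 \<Longrightarrow>
      energy (Phi \<phi>) (step h g) \<le> (1 - h * k) * energy (Phi \<phi>) g"
  shows "k * phi_entropy S \<mu> \<phi> f \<le> energy (Phi \<phi>) f"
proof -
  let ?E = "energy (Phi \<phi>)" and ?H = "phi_entropy S \<mu> \<phi>"
  let ?m = "\<Sum>x\<in>S. f x * \<mu> x"
  define F where "F n = (step h ^^ n) f" for n
  have h0: "h \<ge> 0" using h by simp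
  have pos: "\<forall>x\<in>S. F n x > 0" for n unfolding F_def by (rule iterate_pos[OF f h0 h(2)])
  have Phi_nonneg: "Phi \<phi> a b \<ge> 0" if "a > 0" "b > 0" for a b
    using tangent[OF that] tangent[OF that(2,1)] by (simp add: Phi_def algebra_simps)
  have dec: "?E (F n) - k * ?H (F n) \<le> ?E f - k * ?H f" for n
  proof (induction n)
    case (Suc n)
    have F: "F (Suc n) = step h (F n)" by (simp add: F_def)
    have "k * (?H (F n) - ?H (F (Suc n))) \<le> k * (h * ?E (F n))"
      using entropy_step[OF tangent pos h0 h(2)] k F by (intro mult_left_mono) auto
    moreover have "?E (F (Suc n)) \<le> (1 - h * k) * ?E (F n)" using contr[OF pos] F by simp
    ultimately show ?case using Suc by (simp add: algebra_simps)
  qed (simp add: F_def)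
  \<comment> \<open>The energy of the iterate is merely bounded below by 0, so that the entropy
    alone has to be passed to the limit.\<close>
  have "- k * ?H (F n) \<le> ?E f - k * ?H f" for n
    using dec[of n] energy_nonneg[of "Phi \<phi>", OF Phi_nonneg pos[of n]] by simp
  moreover have "(\<lambda>n. - k * ?H (F n)) \<longlonglongrightarrow> - k * 0"
  proof (intro tendsto_mult tendsto_const)
    have "(\<lambda>n. \<phi> (F n x)) \<longlonglongrightarrow> \<phi> ?m" if "x \<in> S" for x
      using iterate_tendsto_mean[OF f h0 h(2) \<rho> contr2 that] cont[OF mean_pos[OF f]]
      unfolding F_def by (rule isCont_tendsto_compose[rotated])
    then have "(\<lambda>n. (\<Sum>x\<in>S. \<phi> (F n x) * \<mu> x) - \<phi> ?m) \<longlonglongrightarrow> (\<Sum>x\<in>S. \<phi> ?m * \<mu> x) - \<phi> ?m"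
      by (intro tendsto_diff tendsto_sum tendsto_mult tendsto_const)
    then show "(\<lambda>n. ?H (F n)) \<longlonglongrightarrow> 0"
      using \<mu>_sum by (simp add: phi_entropy_def F_def mean_iterate sum_distrib_left[symmetric])
  qed
  ultimately have "- k * 0 \<le> ?E f - k * ?H f" by (intro LIMSEQ_le_const2) auto
  then show ?thesis by simp
qed

end

section \<open>Coupling for the Curie--Weiss dynamics\<close>

declare One_nat_def [simp del]

section \<open>Spin configurations and flips\<close>

lemma flip_apply: "flip i x j = (if j = i then - x i else x j)"
  by (simp add: flip_def)

lemma flip_flip [simp]: "flip i (flip i x) = x"
  by (auto simp: flip_def)

lemma flip_commute: "flip i (flip j x) = flip j (flip i x)"
  by (auto simp: flip_def)

lemma flip_conjugate [simp]: "flip i (flip j (flip i x)) = flip j x"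
  by (subst flip_commute) simp

text \<open>It turns sums over the set of maps \<open>moves N\<close> into sums over sites.\<close>

lemma inj_flip: "inj flip"
proof (rule injI)
  fix i j assume "flip i = flip j"
  then have "flip i (\<lambda>_. 1) i = flip j (\<lambda>_. 1) i" by simp
  then show "i = j" by (simp add: flip_def split: if_splits)
qed

lemma sum_moves: "(\<Sum>\<sigma>\<in>moves N. g \<sigma>) = (\<Sum>i\<in>{1..N}. g (flip i))"
  unfolding moves_def by (subst sum.reindex) (auto intro: inj_on_subset[OF inj_flip])

lemma flip_in_configs: "i \<in> {1..N} \<Longrightarrow> x \<in> configs N \<Longrightarrow> flip i x \<in> configs N"
  by (auto simp: configs_def flip_def PiE_def extensional_def Pi_def)

lemma configs_cases: "x \<in> configs N \<Longrightarrow> i \<in> {1..N} \<Longrightarrow> x i = 1 \<or> x i = -1"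
  by (auto simp: configs_def PiE_def Pi_def)

lemma finite_configs: "finite (configs N)"
  unfolding configs_def by (intro finite_PiE) auto

lemma configs_not_empty: "configs N \<noteq> {}"
  by (simp add: configs_def PiE_eq_empty_iff)

lemma configs_connected:
  assumes x: "x \<in> configs N" and y: "y \<in> configs N"
  shows "(\<lambda>x y. x \<in> configs N \<and> (\<exists>i\<in>{1..N}. y = flip i x))\<^sup>*\<^sup>* x y" (is "?R\<^sup>*\<^sup>* x y")
proof -
  \<comment> \<open>\<open>z k\<close> has passed from \<open>x\<close> to \<open>y\<close> at the
    sites up to \<open>k\<close>. Index 0 lies outside {1..N}, where both are
    \<open>undefined\<close>, so \<open>z 0\<close> is \<open>x\<close>.\<close>
  define z where "z k = (\<lambda>i. if i \<le> k then y i else x i)" for k :: nat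
  have z: "z k \<in> configs N" for k
    using x y by (auto simp: z_def configs_def PiE_def extensional_def Pi_def)
  have path: "?R\<^sup>*\<^sup>* (z 0) (z k)" if "k \<le> N" for k
    using that
  proof (induction k)
    case (Suc k)
    show ?case
    proof (cases "x (Suc k) = y (Suc k)")
      case True
      then have "z (Suc k) = z k" by (auto simp: z_def le_Suc_eq)
      then show ?thesis using Suc by simp
    next
      case False
      have k: "Suc k \<in> {1..N}" using Suc.prems by simp
      then have "y (Suc k) = - x (Suc k)"
        using False configs_cases[OF x k] configs_cases[OF y k] by auto
      then have "z (Suc k) = flip (Suc k) (z k)" by (auto simp: z_def le_Suc_eq flip_def)
      then have "?R (z k) (z (Suc k))" using z k by blast
      with Suc.IH[OF Suc_leD[OF Suc.prems]] show ?thesis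
        by (rule rtranclp.rtrancl_into_rtrancl[of ?R])
    qed
  qed simp
  have "z 0 = x" "z N = y"
    using x y by (auto simp: z_def configs_def PiE_def extensional_def fun_eq_iff)
  then show ?thesis using path[of N] by simp
qed

locale curie_weiss =
  fixes N :: nat and \<beta> :: real
  assumes N: "N \<ge> 1" and \<beta>: "\<beta> > 0"
    and high_temperature: "(real N - 1) * (exp (2 * \<beta> / real N) - 1) \<le> 1"
begin

abbreviation "r \<equiv> exp (2 * \<beta> / real N)"
abbreviation "c x i \<equiv> rate_CW \<beta> N x (flip i)"
abbreviation "\<mu> \<equiv> gibbs_CW \<beta> N"

text \<open>The square root of the unnormalised Gibbs weight: rates are quotients of its values and
  the measure is its square, so edge weights become products of two values.\<close>

definition u :: "config \<Rightarrow> real" where "u x = exp (- (\<beta> / 2) * H_CW N x)"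

lemma u_pos: "u x > 0" by (simp add: u_def)

lemma r_ge_1: "r \<ge> 1" using \<beta> by simp

lemma rate_eq: "c x i = u (flip i x) / u x"
  by (simp add: rate_CW_def u_def right_diff_distrib flip: exp_diff)

lemma gibbs_eq: "\<mu> x = (u x)\<^sup>2 / Z_CW \<beta> N"
  by (simp add: gibbs_CW_def u_def power2_eq_square flip: exp_add)

lemma Z_pos: "Z_CW \<beta> N > 0"
  unfolding Z_CW_def by (intro sum_pos) (auto simp: finite_configs configs_not_empty)

lemma H_eq: "H_CW N x = - (1 / (2 * real N)) * (\<Sum>j\<in>{1..N}. x j)\<^sup>2"
  by (simp add: H_CW_def power2_eq_square sum_product)

lemma sum_flip: "i \<in> {1..N} \<Longrightarrow> (\<Sum>j\<in>{1..N}. flip i x j) = (\<Sum>j\<in>{1..N}. x j) - 2 * x i"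
proof -
  assume i: "i \<in> {1..N}"
  have "(\<Sum>j\<in>{1..N} - {i}. flip i x j) = (\<Sum>j\<in>{1..N} - {i}. x j)"
    by (rule sum.cong) (auto simp: flip_def)
  then show ?thesis
    using sum.remove[OF _ i, of x] sum.remove[OF _ i, of "flip i x"] by (simp add: flip_def)
qed

text \<open>The second difference of the quadratic Hamiltonian in directions i and j involves only x
  i * x j, so this cross ratio does not depend on the other spins.\<close>

lemma u_cross:
  assumes "i \<in> {1..N}" "j \<in> {1..N}" "i \<noteq> j"
  shows "u (flip j (flip i x)) * u x = exp (2 * \<beta> / real N * (x i * x j)) * (u (flip i x) * u (flip j x))"
proof -
  define s where "s = (\<Sum>j\<in>{1..N}. x j)"
  have "- (\<beta> / 2) * H_CW N (flip j (flip i x)) + - (\<beta> / 2) * H_CW N x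
      = 2 * \<beta> / real N * (x i * x j) + (- (\<beta> / 2) * H_CW N (flip i x) + - (\<beta> / 2) * H_CW N (flip j x))"
    using N unfolding H_eq sum_flip[OF assms(1)] sum_flip[OF assms(2)] s_def[symmetric]
    using assms(3) by (simp add: flip_apply field_simps power2_eq_square)
  then show ?thesis unfolding u_def by (simp only: flip: exp_add)
qed

sublocale chain: involutive_chain "configs N" "{1..N}" flip c \<mu>
proof
  show "\<mu> (flip i x) * c (flip i x) i = \<mu> x * c x i" for i x
    using u_pos[of x] u_pos[of "flip i x"] by (simp add: gibbs_eq rate_eq power2_eq_square)
  show "sum \<mu> (configs N) = 1"
  proof -
    have "sum \<mu> (configs N) = (\<Sum>\<eta>\<in>configs N. exp (- \<beta> * H_CW N \<eta>)) / Z_CW \<beta> N"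
      by (simp add: gibbs_CW_def sum_divide_distrib)
    then show ?thesis using Z_pos by (simp add: Z_CW_def)
  qed
  show "\<mu> x > 0" for x using u_pos[of x] Z_pos by (simp add: gibbs_eq)
  show "(\<lambda>x y. x \<in> configs N \<and> (\<exists>i\<in>{1..N}. y = flip i x))\<^sup>*\<^sup>* x y"
    if "x \<in> configs N" "y \<in> configs N" for x y using that by (rule configs_connected)
qed (auto simp: finite_configs flip_in_configs rate_eq u_pos)

section \<open>Rates in terms of the number of agreeing spins\<close>

definition n :: "config \<Rightarrow> nat \<Rightarrow> nat" where
  "n x i = card {j \<in> {1..N} - {i}. x j = x i}"

lemma opposite_iff:
  "x \<in> configs N \<Longrightarrow> i \<in> {1..N} \<Longrightarrow> j \<in> {1..N} \<Longrightarrow> x j = - x i \<longleftrightarrow> x j \<noteq> x i"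
  using configs_cases[of x N i] configs_cases[of x N j] by auto

lemma n_flip:
  assumes "x \<in> configs N" "i \<in> {1..N}"
  shows "n (flip i x) i = N - 1 - n x i"
proof -
  have "{j \<in> {1..N} - {i}. flip i x j = flip i x i} = ({1..N} - {i}) - {j \<in> {1..N} - {i}. x j = x i}"
    using opposite_iff[OF assms] by (auto simp: flip_apply)
  moreover have "card (({1..N} - {i}) - {j \<in> {1..N} - {i}. x j = x i})
      = card ({1..N} - {i}) - card {j \<in> {1..N} - {i}. x j = x i}"
    by (rule card_Diff_subset) auto
  moreover have "card ({1..N} - {i}) = N - 1" using assms by simp
  ultimately show ?thesis unfolding n_def by simp
qed

lemma n_le: "i \<in> {1..N} \<Longrightarrow> n x i \<le> N - 1"
proof -
  assume "i \<in> {1..N}"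
  then have "card ({1..N} - {i}) = N - 1" by simp
  moreover have "card {j \<in> {1..N} - {i}. x j = x i} \<le> card ({1..N} - {i})"
    by (rule card_mono) auto
  ultimately show ?thesis by (simp only: n_def)
qed

text \<open>Each of the \<open>n x i\<close> agreeing spins contributes 1, and each of the remaining
  ones -1, to x i times the sum of the other spins.\<close>

lemma rate_eq_exp:
  assumes x: "x \<in> configs N" and i: "i \<in> {1..N}"
  shows "c x i = exp (\<beta> / real N * (real N - 1 - 2 * real (n x i)))"
proof -
  let ?J = "{1..N} - {i}" and ?K = "{j \<in> {1..N} - {i}. x j = x i}"
  have "x i * (\<Sum>j\<in>?J. x j) = (\<Sum>j\<in>?J. if j \<in> ?K then 1 else - 1)"
    unfolding sum_distrib_left
  proof (rule sum.cong)
    fix j assume "j \<in> ?J"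
    then show "x i * x j = (if j \<in> ?K then 1 else - 1)"
      using configs_cases[OF x i] configs_cases[OF x, of j] by auto
  qed simp
  also have "\<dots> = 2 * real (card ?K) - real (card ?J)"
  proof -
    have "(\<Sum>j\<in>?J. if j \<in> ?K then 1 else - 1 :: real) = (\<Sum>j\<in>?J. 2 * (if j \<in> ?K then 1 else 0) - 1)"
      by (intro sum.cong) auto
    also have "\<dots> = 2 * (\<Sum>j\<in>?J. if j \<in> ?K then 1 else 0) - real (card ?J)"
      by (simp add: sum_subtractf sum_distrib_left)
    also have "(\<Sum>j\<in>?J. if j \<in> ?K then 1 else 0 :: real) = real (card ?K)"
      by (subst sum.inter_restrict[symmetric]) (auto simp: Int_def intro: arg_cong[where f = card])
    finally show ?thesis .
  qed
  also have "\<dots> = 2 * real (n x i) - (real N - 1)" using i by (simp add: n_def of_nat_diff)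
  finally have *: "x i * (\<Sum>j\<in>?J. x j) = 2 * real (n x i) - (real N - 1)" .
  have "- \<beta> * x i * (1 / real N * (\<Sum>j\<in>?J. x j)) = - \<beta> / real N * (x i * (\<Sum>j\<in>?J. x j))"
    by simp
  also have "\<dots> = \<beta> / real N * (real N - 1 - 2 * real (n x i))"
    unfolding * by (simp add: algebra_simps)
  finally have "- \<beta> * x i * (1 / real N * (\<Sum>j\<in>?J. x j))
      = \<beta> / real N * (real N - 1 - 2 * real (n x i))" .
  then show ?thesis unfolding rate_CW_flip[OF i] by simp
qed

text \<open>A crude uniform bound, from which the size of the time step is chosen.\<close>

lemma rate_le:
  assumes "x \<in> configs N" "i \<in> {1..N}"
  shows "c x i \<le> exp \<beta>"
proof -
  have "\<beta> / real N * (real N - 1 - 2 * real (n x i)) \<le> \<beta> / real N * real N"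
    using \<beta> by (intro mult_left_mono) auto
  then show ?thesis using N by (simp add: rate_eq_exp[OF assms])
qed

text \<open>Spins of equal sign see equally many agreeing others: their common class without
  themselves.\<close>

lemma rate_cong:
  assumes "x \<in> configs N" "i \<in> {1..N}" "j \<in> {1..N}" "x j = x i"
  shows "c x j = c x i"
proof -
  have *: "n x k = card {l \<in> {1..N}. x l = x k} - 1" if "k \<in> {1..N}" for k
  proof -
    have "{l \<in> {1..N} - {k}. x l = x k} = {l \<in> {1..N}. x l = x k} - {k}" by auto
    then show ?thesis unfolding n_def using that by (simp add: card_Diff_singleton)
  qed
  have "n x i = n x j" unfolding *[OF assms(2)] *[OF assms(3)] assms(4) ..
  then show ?thesis using assms by (simp add: rate_eq_exp)
qed

lemma rate_flip_same:
  assumes "x \<in> configs N" "i \<in> {1..N}" "j \<in> {1..N}" "i \<noteq> j" "x j = x i"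
  shows "c (flip i x) j = r * c x j"
proof -
  have "x i * x i = 1" using configs_cases[OF assms(1,2)] by auto
  then have "u (flip j (flip i x)) * u x = r * (u (flip i x) * u (flip j x))"
    using u_cross[OF assms(2-4), of x] assms(5) by simp
  then show ?thesis using u_pos[of x] u_pos[of "flip i x"] by (simp add: rate_eq field_simps)
qed

text \<open>For neighbours \<open>x\<close> and \<open>flip i x\<close>, spin \<open>j\<close> is flipped in both at the smaller of the two rates
  \<open>c x j\<close> and \<open>c (flip i x) j\<close>. The larger one is \<open>r\<close> times the smaller.\<close>
definition p :: "config \<Rightarrow> nat \<Rightarrow> nat \<Rightarrow> real" where
  "p x i j = (if x j = x i then c x j else c (flip i x) j)"

text \<open>The excess of the flips of \<open>j\<close> is coupled with the flip of \<open>i\<close> at the other state; what is left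
  of the flip of \<open>i\<close> makes the two chains merge.\<close>
definition merge_rate :: "config \<Rightarrow> nat \<Rightarrow> real" where
  "merge_rate x i = c x i * (1 - real (n x i) * (r - 1))"

lemma p_pos: "p x i j > 0"
  by (simp add: p_def rate_eq u_pos)

lemma p_flip:
  assumes "x \<in> configs N" "i \<in> {1..N}" "j \<in> {1..N}" "i \<noteq> j"
  shows "p (flip i x) i j = p x i j"
  using opposite_iff[OF assms(1-3)] assms(4) configs_cases[OF assms(1,2)]
  by (auto simp: p_def flip_apply)

lemma p_excess:
  assumes "x \<in> configs N" "i \<in> {1..N}" "j \<in> {1..N}" "i \<noteq> j"
  shows "r * p x i j = (if x j = x i then c (flip i x) j else c x j)"
proof (cases "x j = x i")
  case True
  then show ?thesis using rate_flip_same[OF assms] by (simp add: p_def)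
next
  case False
  then have "flip i x j = flip i x i" using opposite_iff[OF assms(1-3)] assms(4) by (simp add: flip_apply)
  then have "c (flip i (flip i x)) j = r * c (flip i x) j"
    by (intro rate_flip_same flip_in_configs assms)
  then show ?thesis using False by (simp add: p_def)
qed

lemma p_le: 
  assumes "x \<in> configs N" "i \<in> {1..N}" "j \<in> {1..N}" "i \<noteq> j"
  shows "r * p x i j \<le> exp \<beta>"
  unfolding p_excess[OF assms]
  using rate_le[OF assms(1,3)] rate_le[OF flip_in_configs[OF assms(2,1)] assms(3)] by simp

text \<open>The value of \<open>f\<close> after the excess move of site j, seen from
  \<open>x\<close>: if spins i and j agree, \<open>x\<close> is the slower state for j and flips i
  instead.\<close>

definition partner :: "(config \<Rightarrow> real) \<Rightarrow> config \<Rightarrow> nat \<Rightarrow> nat \<Rightarrow> real" where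
  "partner f x i j = (if x j = x i then f (flip i x) else f (flip j x))"

text \<open>Each agreeing j claims the rate (r - 1) * c x j of the flip of i, which is (r - 1) * c x
  i by \<open>rate_cong\<close>. Subtracting it for all \<open>n x i\<close> such j leaves exactly
  \<open>merge_rate x i\<close>.\<close>

lemma step_decomposition:
  assumes x: "x \<in> configs N" and i: "i \<in> {1..N}"
  shows "chain.step h f x = f x + h * merge_rate x i * (f (flip i x) - f x)
     + (\<Sum>j\<in>{1..N} - {i}. h * p x i j * (f (flip j x) - f x) + h * (r - 1) * p x i j * (partner f x i j - f x))"
proof -
  let ?J = "{1..N} - {i}" and ?d = "f (flip i x) - f x"
  have "p x i j * (f (flip j x) - f x) + (r - 1) * p x i j * (partner f x i j - f x)
      = c x j * (f (flip j x) - f x) + (if x j = x i then (r - 1) * c x i * ?d else 0)"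
    if j: "j \<in> ?J" for j
  proof (cases "x j = x i")
    case True
    then show ?thesis using rate_cong[OF x i] j by (simp add: p_def partner_def)
  next
    case False
    have "p x i j * (f (flip j x) - f x) + (r - 1) * p x i j * (partner f x i j - f x)
      = r * p x i j * (f (flip j x) - f x)" using False by (simp add: partner_def algebra_simps)
    also have "r * p x i j = c x j" using p_excess[OF x i, of j] j False by simp
    finally show ?thesis using False by simp
  qed
  then have "(\<Sum>j\<in>?J. p x i j * (f (flip j x) - f x) + (r - 1) * p x i j * (partner f x i j - f x))
      = (\<Sum>j\<in>?J. c x j * (f (flip j x) - f x)) + (\<Sum>j\<in>?J. if x j = x i then (r - 1) * c x i * ?d else 0)"
    by (simp add: sum.distrib)
  also have "(\<Sum>j\<in>?J. if x j = x i then (r - 1) * c x i * ?d else 0) = real (n x i) * ((r - 1) * c x i * ?d)"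
    unfolding n_def by (subst sum.inter_filter[symmetric]) auto
  finally have *: "(\<Sum>j\<in>?J. p x i j * (f (flip j x) - f x) + (r - 1) * p x i j * (partner f x i j - f x))
      = (\<Sum>j\<in>?J. c x j * (f (flip j x) - f x)) + real (n x i) * ((r - 1) * c x i * ?d)" .
  have "chain.step h f x = f x + h * (c x i * ?d + (\<Sum>j\<in>?J. c x j * (f (flip j x) - f x)))"
    unfolding chain.step_def by (subst sum.remove[OF _ i]) auto
  also have "\<dots> = f x + h * merge_rate x i * ?d
      + h * ((\<Sum>j\<in>?J. c x j * (f (flip j x) - f x)) + real (n x i) * ((r - 1) * c x i * ?d))"
    by (simp add: merge_rate_def algebra_simps)
  also note *[symmetric]
  finally show ?thesis by (simp add: sum_distrib_left distrib_left mult.assoc)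
qed

end

section \<open>Edge weights and their symmetries\<close>

lemma sum_off_diagonal_swap:
  fixes g :: "nat \<Rightarrow> nat \<Rightarrow> real"
  shows "(\<Sum>i\<in>{1..N}. \<Sum>j\<in>{1..N} - {i}. g j i) = (\<Sum>i\<in>{1..N}. \<Sum>j\<in>{1..N} - {i}. g i j)"
proof -
  have "{j \<in> {1..N}. j \<noteq> i} = {1..N} - {i}" "{j \<in> {1..N}. i \<noteq> j} = {1..N} - {i}" for i
    by auto
  then show ?thesis
    using sum.swap_restrict[of "{1..N}" "{1..N}" "\<lambda>i j. g j i" "\<lambda>i j. j \<noteq> i"] by simp
qed

context curie_weiss
begin

text \<open>Whichever corner of the square \<open>x\<close> is, the case distinction selects the
  diagonal on which spins i and j differ; both invariances of the weight rest on this.\<close>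

lemma cross_weight:
  assumes x: "x \<in> configs N" and ij: "i \<in> {1..N}" "j \<in> {1..N}" "i \<noteq> j"
  shows "\<mu> x * c x i * p x i j
    = (if x j = x i then u (flip i x) * u (flip j x) else u x * u (flip j (flip i x))) / Z_CW \<beta> N"
  using u_pos[of x] u_pos[of "flip i x"] Z_pos
  by (simp add: gibbs_eq p_def rate_eq power2_eq_square field_simps)

lemma cross_weight_flip:
  assumes x: "x \<in> configs N" and ij: "i \<in> {1..N}" "j \<in> {1..N}" "i \<noteq> j"
  shows "\<mu> (flip j x) * c (flip j x) i * p (flip j x) i j = \<mu> x * c x i * p x i j"
  unfolding cross_weight[OF x ij] cross_weight[OF flip_in_configs[OF ij(2) x] ij]
  using opposite_iff[OF x ij(1,2)] configs_cases[OF x ij(2)] ij(3) flip_commute[of i j x]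
  by (auto simp: flip_apply mult.commute)

text \<open>The excess flips of the coupling of an edge in direction \<open>i\<close> lead to an edge in direction \<open>j\<close>,
  which this weight-preserving involution matches with the edges that are left; hence these flips
  do not change the energy.\<close>
definition both_flip :: "nat \<Rightarrow> nat \<Rightarrow> config \<Rightarrow> config" where
  "both_flip i j x = (if x j = x i then flip i (flip j x) else x)"

lemma both_flip_in: "i \<in> {1..N} \<Longrightarrow> j \<in> {1..N} \<Longrightarrow> x \<in> configs N \<Longrightarrow> both_flip i j x \<in> configs N"
  by (simp add: both_flip_def flip_in_configs)

lemma both_flip_both_flip: "i \<noteq> j \<Longrightarrow> both_flip i j (both_flip i j x) = x"
  by (simp add: both_flip_def flip_apply flip_commute[of i j])

lemma cross_weight_both_flip:
  assumes x: "x \<in> configs N" and ij: "i \<in> {1..N}" "j \<in> {1..N}" "i \<noteq> j"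
  shows "\<mu> (both_flip i j x) * c (both_flip i j x) j * p (both_flip i j x) j i = \<mu> x * c x i * p x i j"
  unfolding cross_weight[OF x ij] cross_weight[OF both_flip_in[OF ij(1,2) x] ij(2,1) ij(3)[symmetric]]
  using ij(3) flip_commute[of i j x]
  by (auto simp: both_flip_def flip_apply mult.commute)

lemma sum_parallel:
  assumes ij: "i \<in> {1..N}" "j \<in> {1..N}" "i \<noteq> j"
  shows "(\<Sum>x\<in>configs N. \<mu> x * c x i * p x i j * \<Psi> (f (flip j x)) (f (flip j (flip i x))))
    = (\<Sum>x\<in>configs N. \<mu> x * c x i * p x i j * \<Psi> (f x) (f (flip i x)))"
  unfolding chain.sum_T[OF ij(2), of "\<lambda>x. \<mu> x * c x i * p x i j * \<Psi> (f x) (f (flip i x))", symmetric]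
  by (rule sum.cong) (simp_all only: cross_weight_flip[OF _ ij] flip_commute[of i j])

text \<open>The involution exchanges i and j in the weight, an exchange that summing over all
  ordered pairs undoes. Matched edges are traversed in opposite directions, hence the symmetry of
  \<open>\<Psi>\<close>.\<close>

lemma sum_excess:
  assumes ij: "i \<in> {1..N}" "j \<in> {1..N}" "i \<noteq> j" and sym: "\<And>a b. \<Psi> a b = \<Psi> b a"
  shows "(\<Sum>x\<in>configs N. \<mu> x * c x i * p x i j * \<Psi> (partner f x i j) (partner f (flip i x) i j))
    = (\<Sum>x\<in>configs N. \<mu> x * c x j * p x j i * \<Psi> (f x) (f (flip j x)))"
proof (rule sum.reindex_bij_witness[of _ "both_flip i j" "both_flip i j"])
  fix x assume x: "x \<in> configs N"
  have "\<Psi> (f (both_flip i j x)) (f (flip j (both_flip i j x)))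
      = \<Psi> (partner f x i j) (partner f (flip i x) i j)"
    using opposite_iff[OF x ij(1,2)] configs_cases[OF x ij(1)] ij(3) sym flip_commute[of i j x]
    by (auto simp: both_flip_def partner_def flip_apply)
  then show "\<mu> (both_flip i j x) * c (both_flip i j x) j * p (both_flip i j x) j i
      * \<Psi> (f (both_flip i j x)) (f (flip j (both_flip i j x)))
    = \<mu> x * c x i * p x i j * \<Psi> (partner f x i j) (partner f (flip i x) i j)"
    by (simp only: cross_weight_both_flip[OF x ij])
qed (use ij in \<open>auto simp: both_flip_both_flip both_flip_in\<close>)

section \<open>Contraction of the energy in one step\<close>

lemma sum_p_le:
  assumes "x \<in> configs N" "i \<in> {1..N}"
  shows "r * (\<Sum>j\<in>{1..N} - {i}. p x i j) \<le> real N * exp \<beta>"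
proof -
  have "r * (\<Sum>j\<in>{1..N} - {i}. p x i j) \<le> (\<Sum>j\<in>{1..N} - {i}. exp \<beta>)"
    unfolding sum_distrib_left using assms by (intro sum_mono p_le) auto
  also have "\<dots> \<le> (\<Sum>j\<in>{1..N}. exp \<beta>)" by (intro sum_mono2) auto
  finally show ?thesis by simp
qed

lemma merge_rate_le:
  assumes "x \<in> configs N" "i \<in> {1..N}"
  shows "merge_rate x i \<le> exp \<beta>"
proof -
  have "merge_rate x i \<le> c x i * 1"
    unfolding merge_rate_def using r_ge_1 by (intro mult_left_mono) (auto simp: rate_eq u_pos less_imp_le)
  then show ?thesis using rate_le[OF assms] by simp
qed

text \<open>Merging is performed on the pair before Jensen is applied: the base point is the merged
  pair \<open>z\<close>, not the pair of values on the edge. This exploits the full contraction in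
  \<open>merge_contracts\<close>, beyond what convexity gives.\<close>

lemma step_coupling:
  assumes conv: "convex_on ({0<..} \<times> {0<..}) (\<lambda>(a, b). \<Psi> a b)"
    and nonneg: "\<And>a b. a > 0 \<Longrightarrow> b > 0 \<Longrightarrow> \<Psi> a b \<ge> 0"
    and merge: "merge_contracts \<Psi> l k k'"
    and l: "0 \<le> l" "l \<le> merge_rate x i" "l \<le> merge_rate (flip i x) i"
    and k: "0 \<le> k" "0 \<le> k'" "k \<le> merge_rate x i + merge_rate (flip i x) i"
    and f: "\<forall>x\<in>configs N. f x > 0" and h: "0 < h" "4 * h * real N * exp \<beta> \<le> 1"
    and x: "x \<in> configs N" and i: "i \<in> {1..N}"
  shows "\<Psi> (chain.step h f x) (chain.step h f (flip i x))
    \<le> (\<Sum>j\<in>{1..N} - {i}. h * p x i j * \<Psi> (f (flip j x)) (f (flip j (flip i x)))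
         + h * (r - 1) * p x i j * \<Psi> (partner f x i j) (partner f (flip i x) i j))
      + (1 - h * (\<Sum>j\<in>{1..N} - {i}. r * p x i j) - h * (k + k' - 2 * h * k * k')) * \<Psi> (f x) (f (flip i x))"
proof -
  define J where "J = {1..N} - {i}"
  define y where "y = flip i x"
  define A B where "A = merge_rate x i" and "B = merge_rate y i"
  define a b where "a = f x" and "b = f y"
  have y: "y \<in> configs N" using flip_in_configs[OF i x] by (simp add: y_def)
  have J: "j \<in> {1..N}" "i \<noteq> j" if "j \<in> J" for j using that by (auto simp: J_def)
  \<comment> \<open>The index (j, True) stands for the simultaneous flip of j, and (j, False) for
    the excess.\<close>
  define w where "w = (\<lambda>(j, e). if e then h * p x i j else h * (r - 1) * p x i j)"
  define q where "q = (\<lambda>(j, e). if e then (f (flip j x), f (flip j y)) else (partner f x i j, partner f y i j))"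
  define W where "W = sum w (J \<times> UNIV)"
  have sum_JU: "(\<Sum>k\<in>J \<times> UNIV. g k :: 'z::comm_monoid_add) = (\<Sum>j\<in>J. g (j, True) + g (j, False))" for g
    by (simp add: sum.cartesian_product' UNIV_bool add.commute)
  have W: "W = h * (\<Sum>j\<in>J. r * p x i j)"
    by (simp add: W_def sum_JU w_def sum_distrib_left algebra_simps)
  have hN: "h * (real N * exp \<beta>) \<le> 1 / 4" using h(2) by (simp add: mult_ac)
  have "1 * (h * exp \<beta>) \<le> real N * (h * exp \<beta>)" using N h by (intro mult_right_mono) auto
  then have h1: "4 * (h * exp \<beta>) \<le> 1" using hN by (simp add: mult_ac)
  have "W \<le> h * (real N * exp \<beta>)"
    unfolding W using sum_p_le[OF x i] h by (intro mult_left_mono) (auto simp: J_def sum_distrib_left)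
  then have W_le: "W \<le> 1 / 2" using hN by simp
  have W0: "W \<ge> 0" unfolding W using h p_pos by (intro mult_nonneg_nonneg sum_nonneg) (auto simp: less_imp_le)
  \<comment> \<open>Jensen gives \<open>z\<close> only the weight 1 - W, so the merging time is
    stretched until the resulting displacement is that of time \<open>h\<close>. As W \<le> 1/2, it
    stays below 2 * h.\<close>
  define t where "t = h / (1 - W)"
  have t: "t \<ge> 0" "t \<le> 2 * h" "(1 - W) * t = h" using h W_le by (auto simp: t_def field_simps)
  have AB: "0 \<le> l" "l \<le> A" "l \<le> B" "k \<le> A + B" using l k by (auto simp: A_def B_def y_def)
  \<comment> \<open>Both merging rates are at most exp \<beta>, so the bound is 4 * h * exp \<beta>;
    this uses up the factor 4 in the hypothesis on \<open>h\<close>.\<close>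
  have "t * (A + B) \<le> 2 * h * (exp \<beta> + exp \<beta>)"
    using t AB h merge_rate_le[OF x i] merge_rate_le[OF y i]
    by (intro mult_mono) (auto simp: A_def B_def)
  then have tAB: "t * (A + B) \<le> 1" using h1 by simp
  have ab: "a > 0" "b > 0" using f x y by (auto simp: a_def b_def)
  define z where "z = (a + t * A * (b - a), b - t * B * (b - a))"
  have z: "z \<in> {0<..} \<times> {0<..}"
    using merged_pos[of a b t A B] ab t AB tAB by (simp add: z_def)
  have q: "q k \<in> {0<..} \<times> {0<..}" if "k \<in> J \<times> UNIV" for k
    using that f x y J(1) i by (auto simp: q_def partner_def flip_in_configs)
  have "chain.step h f x = fst (z + (\<Sum>k\<in>J \<times> UNIV. w k *\<^sub>R (q k - z)))"
  proof -
    have "chain.step h f x = a + h * A * (b - a)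
        + (\<Sum>j\<in>J. h * p x i j * (f (flip j x) - a) + h * (r - 1) * p x i j * (partner f x i j - a))"
      unfolding step_decomposition[OF x i] by (simp add: A_def a_def b_def y_def J_def)
    also have "(\<Sum>j\<in>J. h * p x i j * (f (flip j x) - a) + h * (r - 1) * p x i j * (partner f x i j - a))
        = (\<Sum>k\<in>J \<times> UNIV. w k * (fst (q k) - a))"
      by (simp add: sum_JU w_def q_def)
    \<comment> \<open>Moving the base point from \<open>a\<close> to \<open>fst z\<close> leaves
      \<open>W\<close> times the merging displacement; with the share 1 - W of the merging term it
      adds up to \<open>fst z - a\<close>.\<close>
    also have "\<dots> = (\<Sum>k\<in>J \<times> UNIV. w k * (fst (q k) - fst z)) + W * (t * A * (b - a))"
      unfolding W_def sum_distrib_right sum.distrib[symmetric]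
      by (intro sum.cong) (auto simp: z_def algebra_simps)
    also have "h * A * (b - a) = (1 - W) * t * A * (b - a)" by (simp add: t(3))
    finally show ?thesis by (simp add: fst_sum z_def algebra_simps)
  qed
  moreover have "chain.step h f y = snd (z + (\<Sum>k\<in>J \<times> UNIV. w k *\<^sub>R (q k - z)))"
  proof -
    have "chain.step h f y = b + h * B * (a - b)
        + (\<Sum>j\<in>J. h * p y i j * (f (flip j y) - b) + h * (r - 1) * p y i j * (partner f y i j - b))"
      unfolding step_decomposition[OF y i] by (simp add: B_def a_def b_def y_def J_def)
    also have "(\<Sum>j\<in>J. h * p y i j * (f (flip j y) - b) + h * (r - 1) * p y i j * (partner f y i j - b))
        = (\<Sum>j\<in>J. h * p x i j * (f (flip j y) - b) + h * (r - 1) * p x i j * (partner f y i j - b))"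
      using p_flip[OF x i] J by (intro sum.cong) (auto simp: y_def)
    also have "\<dots> = (\<Sum>k\<in>J \<times> UNIV. w k * (snd (q k) - b))"
      by (simp add: sum_JU w_def q_def)
    also have "\<dots> = (\<Sum>k\<in>J \<times> UNIV. w k * (snd (q k) - snd z)) + W * (t * B * (a - b))"
      unfolding W_def sum_distrib_right sum.distrib[symmetric]
      by (intro sum.cong) (auto simp: z_def algebra_simps)
    also have "h * B * (a - b) = (1 - W) * t * B * (a - b)" by (simp add: t(3))
    finally show ?thesis by (simp add: snd_sum z_def algebra_simps)
  qed
  ultimately have "\<Psi> (chain.step h f x) (chain.step h f y)
      = (\<lambda>(a, b). \<Psi> a b) (z + (\<Sum>k\<in>J \<times> UNIV. w k *\<^sub>R (q k - z)))"
    by (simp add: case_prod_beta)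
  also have "\<dots> \<le> (\<Sum>k\<in>J \<times> UNIV. w k * (\<lambda>(a, b). \<Psi> a b) (q k)) + (1 - W) * (\<lambda>(a, b). \<Psi> a b) z"
    unfolding W_def
  proof (rule convex_on_sum_base[OF conv _ _ _ q z])
    show "w k \<ge> 0" if "k \<in> J \<times> UNIV" for k
      using h r_ge_1 p_pos by (auto simp: w_def case_prod_beta less_imp_le)
    show "sum w (J \<times> UNIV) \<le> 1" using W_le by (simp add: W_def)
  qed (auto simp: J_def)
  also have "(\<Sum>k\<in>J \<times> UNIV. w k * (\<lambda>(a, b). \<Psi> a b) (q k))
      = (\<Sum>j\<in>J. h * p x i j * \<Psi> (f (flip j x)) (f (flip j y))
         + h * (r - 1) * p x i j * \<Psi> (partner f x i j) (partner f y i j))"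
    by (simp add: sum_JU w_def q_def)
  also have "(1 - W) * (\<lambda>(a, b). \<Psi> a b) z
      \<le> (1 - h * (\<Sum>j\<in>J. r * p x i j) - h * (k + k' - 2 * h * k * k')) * \<Psi> a b"
  proof -
    have "(\<lambda>(a, b). \<Psi> a b) z \<le> (1 - t * k) * (1 - t * k') * \<Psi> a b"
      using merge ab t AB tAB unfolding merge_contracts_def z_def by simp
    then have "(1 - W) * (\<lambda>(a, b). \<Psi> a b) z \<le> (1 - W) * ((1 - t * k) * (1 - t * k') * \<Psi> a b)"
      using W_le by (intro mult_left_mono) auto
    also have "\<dots> = (1 - W - (1 - W) * t * (k + k') + (1 - W) * t * t * k * k') * \<Psi> a b"
      by (simp add: algebra_simps)
    also have "\<dots> = (1 - W - h * (k + k') + h * t * k * k') * \<Psi> a b"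
      by (simp only: t(3))
    \<comment> \<open>Multiplying the two contractions leaves the second-order term h * t * k * k',
      and t \<le> 2 * h produces the constant 2.\<close>
    also have "\<dots> \<le> (1 - W - h * (k + k') + h * (2 * h) * k * k') * \<Psi> a b"
      using t h k nonneg[OF ab] by (intro mult_right_mono add_left_mono mult_left_mono) auto
    finally show ?thesis by (simp add: W algebra_simps)
  qed
  finally show ?thesis by (simp add: J_def y_def a_def b_def)
qed

lemma energy_step_le:
  assumes conv: "convex_on ({0<..} \<times> {0<..}) (\<lambda>(a, b). \<Psi> a b)"
    and nonneg: "\<And>a b. a > 0 \<Longrightarrow> b > 0 \<Longrightarrow> \<Psi> a b \<ge> 0" and sym: "\<And>a b. \<Psi> a b = \<Psi> b a"
    and merge: "merge_contracts \<Psi> l k k'"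
    and l: "0 \<le> l" "\<And>x i. x \<in> configs N \<Longrightarrow> i \<in> {1..N} \<Longrightarrow> l \<le> merge_rate x i"
    and k: "0 \<le> k" "0 \<le> k'" "\<And>x i. x \<in> configs N \<Longrightarrow> i \<in> {1..N} \<Longrightarrow> k \<le> merge_rate x i + merge_rate (flip i x) i"
    and f: "\<forall>x\<in>configs N. f x > 0" and h: "0 < h" "4 * h * real N * exp \<beta> \<le> 1"
  shows "chain.energy \<Psi> (chain.step h f) \<le> (1 - h * (k + k' - 2 * h * k * k')) * chain.energy \<Psi> f"
proof -
  define \<epsilon> where "\<epsilon> = h * (k + k' - 2 * h * k * k')"
  define V where "V x i = \<Psi> (f x) (f (flip i x))" for x i
  define P where "P x i j = \<Psi> (f (flip j x)) (f (flip j (flip i x)))" for x i j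
  define Q where "Q x i j = \<Psi> (partner f x i j) (partner f (flip i x) i j)" for x i j
  define m where "m x i j = \<mu> x * c x i * p x i j" for x i j
  let ?S = "configs N" and ?J = "\<lambda>i. {1..N} - {i}"
  have swap: "(\<Sum>x\<in>?S. \<Sum>i\<in>{1..N}. \<Sum>j\<in>?J i. g x i j) = (\<Sum>i\<in>{1..N}. \<Sum>j\<in>?J i. \<Sum>x\<in>?S. g x i j)"
    for g :: "config \<Rightarrow> nat \<Rightarrow> nat \<Rightarrow> real"
    by (subst sum.swap) (intro sum.cong refl sum.swap)
  have P: "(\<Sum>x\<in>?S. \<Sum>i\<in>{1..N}. \<Sum>j\<in>?J i. m x i j * P x i j) = (\<Sum>x\<in>?S. \<Sum>i\<in>{1..N}. \<Sum>j\<in>?J i. m x i j * V x i)"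
    unfolding swap m_def P_def V_def by (intro sum.cong refl sum_parallel) auto
  have "(\<Sum>x\<in>?S. \<Sum>i\<in>{1..N}. \<Sum>j\<in>?J i. m x i j * Q x i j)
      = (\<Sum>i\<in>{1..N}. \<Sum>j\<in>?J i. \<Sum>x\<in>?S. m x j i * V x j)"
    unfolding swap m_def Q_def V_def by (intro sum.cong refl sum_excess sym) auto
  then have Q: "(\<Sum>x\<in>?S. \<Sum>i\<in>{1..N}. \<Sum>j\<in>?J i. m x i j * Q x i j)
      = (\<Sum>x\<in>?S. \<Sum>i\<in>{1..N}. \<Sum>j\<in>?J i. m x i j * V x i)"
    unfolding swap by (subst (asm) sum_off_diagonal_swap)
  have "c x i * \<Psi> (chain.step h f x) (chain.step h f (flip i x)) * \<mu> x
      \<le> h * (\<Sum>j\<in>?J i. m x i j * P x i j) + h * (r - 1) * (\<Sum>j\<in>?J i. m x i j * Q x i j)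
        - h * r * (\<Sum>j\<in>?J i. m x i j * V x i) + (1 - \<epsilon>) * (c x i * V x i * \<mu> x)"
    if x: "x \<in> ?S" and i: "i \<in> {1..N}" for x i
  proof -
    have "c x i * \<Psi> (chain.step h f x) (chain.step h f (flip i x)) * \<mu> x
      \<le> c x i * ((\<Sum>j\<in>?J i. h * p x i j * P x i j + h * (r - 1) * p x i j * Q x i j)
        + (1 - h * (\<Sum>j\<in>?J i. r * p x i j) - \<epsilon>) * V x i) * \<mu> x"
      unfolding P_def Q_def V_def \<epsilon>_def
      using chain.c_pos[OF i x] chain.\<mu>_pos[OF x] flip_in_configs[OF i x]
      by (intro mult_right_mono mult_left_mono step_coupling[OF conv nonneg merge l(1)] l k f h x i) auto
    also have "\<dots> = h * (\<Sum>j\<in>?J i. m x i j * P x i j) + h * (r - 1) * (\<Sum>j\<in>?J i. m x i j * Q x i j)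
        - h * r * (\<Sum>j\<in>?J i. m x i j * V x i) + (1 - \<epsilon>) * (c x i * V x i * \<mu> x)"
      by (simp add: m_def sum.distrib sum_distrib_left sum_distrib_right distrib_left distrib_right
          left_diff_distrib right_diff_distrib sum_subtractf mult_ac)
    finally show ?thesis .
  qed
  then have "(\<Sum>x\<in>?S. \<Sum>i\<in>{1..N}. c x i * \<Psi> (chain.step h f x) (chain.step h f (flip i x)) * \<mu> x)
      \<le> (\<Sum>x\<in>?S. \<Sum>i\<in>{1..N}. h * (\<Sum>j\<in>?J i. m x i j * P x i j)
        + h * (r - 1) * (\<Sum>j\<in>?J i. m x i j * Q x i j)
        - h * r * (\<Sum>j\<in>?J i. m x i j * V x i) + (1 - \<epsilon>) * (c x i * V x i * \<mu> x))"
    by (intro sum_mono)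
  also have "\<dots> = h * (\<Sum>x\<in>?S. \<Sum>i\<in>{1..N}. \<Sum>j\<in>?J i. m x i j * P x i j)
        + h * (r - 1) * (\<Sum>x\<in>?S. \<Sum>i\<in>{1..N}. \<Sum>j\<in>?J i. m x i j * Q x i j)
        - h * r * (\<Sum>x\<in>?S. \<Sum>i\<in>{1..N}. \<Sum>j\<in>?J i. m x i j * V x i)
        + (1 - \<epsilon>) * (\<Sum>x\<in>?S. \<Sum>i\<in>{1..N}. c x i * V x i * \<mu> x)"
    by (simp only: sum.distrib sum_subtractf sum_distrib_left)
  \<comment> \<open>Simultaneous flips, excess flips and lost weight now carry the coefficients h, h
    * (r - 1) and - h * r in front of one and the same sum.\<close>
  also have "\<dots> = (1 - \<epsilon>) * (\<Sum>x\<in>?S. \<Sum>i\<in>{1..N}. c x i * V x i * \<mu> x)"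
    unfolding P Q by (simp add: algebra_simps)
  finally show ?thesis by (simp add: chain.energy_def V_def \<epsilon>_def)
qed

text \<open>This form shows that \<open>f_CW\<close> grows with the distance of m from the middle:
  both coefficients are nonnegative by \<open>high_temperature\<close>, and d enters through the
  increasing functions cosh and d * sinh.\<close>

lemma f_CW_cosh:
  "f_CW \<beta> N m = (2 - (real N - 1) * (r - 1)) * cosh (\<beta> / real N * \<bar>real N - 1 - 2 * of_int m\<bar>)
     + (r - 1) * (\<bar>real N - 1 - 2 * of_int m\<bar> * sinh (\<beta> / real N * \<bar>real N - 1 - 2 * of_int m\<bar>))"
proof -
  define d where "d = real N - 1 - 2 * of_int m"
  define s where "s = \<beta> / real N * d"
  have m: "of_int m = (real N - 1 - d) / 2" by (simp add: d_def)
  have "f_CW \<beta> N m = exp (- s) * (1 - (real N - 1 + d) / 2 * (r - 1)) + exp s * (1 - (real N - 1 - d) / 2 * (r - 1))"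
    unfolding f_CW_def m by (simp add: s_def field_simps)
  also have "\<dots> = (2 - (real N - 1) * (r - 1)) * cosh s + (r - 1) * (d * sinh s)"
    by (simp add: cosh_def sinh_def field_simps)
  finally have "f_CW \<beta> N m = (2 - (real N - 1) * (r - 1)) * cosh s + (r - 1) * (d * sinh s)" .
  moreover have "cosh s = cosh (\<beta> / real N * \<bar>d\<bar>)" "d * sinh s = \<bar>d\<bar> * sinh (\<beta> / real N * \<bar>d\<bar>)"
    by (cases "d \<ge> 0"; simp add: s_def)+
  ultimately show ?thesis unfolding d_def[symmetric] by (simp only:)
qed

lemma kappa_CW_eq: "kappa_CW \<beta> N = f_CW \<beta> N (int ((N - 1) div 2))"
proof -
  have "(real N - 1) / 2 = real (N - 1) / real 2" using N by (simp add: of_nat_diff)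
  then show ?thesis unfolding kappa_CW_def by (simp only: floor_divide_of_nat_eq)
qed

lemma kappa_CW_le:
  assumes "m \<le> N - 1"
  shows "kappa_CW \<beta> N \<le> f_CW \<beta> N (int m)"
proof -
  define d where "d m = \<bar>real N - 1 - 2 * of_int (int m)\<bar>" for m
  define m0 where "m0 = (N - 1) div 2"
  \<comment> \<open>For odd N the minimum is 0; for even N it is 1 and attained at two values of m,
    of which the floor takes the smaller.\<close>
  have "\<bar>int N - 1 - 2 * int m0\<bar> \<le> \<bar>int N - 1 - 2 * int m\<bar>" unfolding m0_def using N by presburger
  then have "real_of_int \<bar>int N - 1 - 2 * int m0\<bar> \<le> real_of_int \<bar>int N - 1 - 2 * int m\<bar>"
    by (simp only: of_int_le_iff)
  then have d: "d m0 \<le> d m" by (simp add: d_def)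
  have d0: "0 \<le> d m0" by (simp add: d_def)
  have w: "\<beta> / real N * d m0 \<le> \<beta> / real N * d m" "0 \<le> \<beta> / real N * d m0"
    using d d0 \<beta> by (auto intro!: mult_left_mono divide_right_mono)
  have "cosh (\<beta> / real N * d m0) \<le> cosh (\<beta> / real N * d m)"
    using w by (simp only: cosh_real_nonneg_le_iff)
  moreover have "d m0 * sinh (\<beta> / real N * d m0) \<le> d m * sinh (\<beta> / real N * d m)"
    using w d d0 by (intro mult_mono) auto
  ultimately show ?thesis
    unfolding kappa_CW_eq f_CW_cosh m0_def[symmetric] d_def[symmetric]
    using high_temperature r_ge_1 by (intro add_mono mult_left_mono) auto
qed

lemma kappa_CW_pos: "kappa_CW \<beta> N > 0"
  unfolding kappa_CW_eq f_CW_cosh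
  using high_temperature r_ge_1 \<beta>
  by (intro add_pos_nonneg mult_pos_pos mult_nonneg_nonneg) auto

lemma merge_rate_sum:
  assumes "x \<in> configs N" "i \<in> {1..N}"
  shows "merge_rate x i + merge_rate (flip i x) i = f_CW \<beta> N (int (n x i))"
proof -
  have "real (N - 1 - n x i) = real N - 1 - real (n x i)" using n_le[OF assms(2), of x] N by simp
  then show ?thesis
    unfolding merge_rate_def rate_eq_exp[OF assms] rate_eq_exp[OF flip_in_configs[OF assms(2,1)] assms(2)]
      n_flip[OF assms] f_CW_def
    by (simp add: algebra_simps)
qed

lemma kappa_CW_le_merge_rates:
  assumes "x \<in> configs N" "i \<in> {1..N}"
  shows "kappa_CW \<beta> N \<le> merge_rate x i + merge_rate (flip i x) i"
  unfolding merge_rate_sum[OF assms] by (intro kappa_CW_le n_le assms)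

lemma kappa_bar_CW_nonneg: "kappa_bar_CW \<beta> N \<ge> 0"
  unfolding kappa_bar_CW_def using high_temperature by simp

text \<open>Both factors of the merging rate decrease in the number of agreeing spins, which is at
  most N - 1.\<close>

lemma kappa_bar_CW_le_merge_rate:
  assumes "x \<in> configs N" "i \<in> {1..N}"
  shows "kappa_bar_CW \<beta> N \<le> merge_rate x i"
  unfolding kappa_bar_CW_def merge_rate_def rate_eq_exp[OF assms]
proof (rule mult_mono)
  have "real (n x i) \<le> real (N - 1)" using n_le[OF assms(2)] by (simp only: of_nat_le_iff)
  then have n: "real (n x i) \<le> real N - 1" using N by simp
  have "\<beta> / real N * (- (real N - 1)) \<le> \<beta> / real N * (real N - 1 - 2 * real (n x i))"
    using n \<beta> by (intro mult_left_mono) auto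
  then show "exp (- (\<beta> / real N) * (real N - 1)) \<le> exp (\<beta> / real N * (real N - 1 - 2 * real (n x i)))"
    by (simp only: exp_le_cancel_iff mult_minus_left mult_minus_right)
  show "1 - (real N - 1) * (r - 1) \<le> 1 - real (n x i) * (r - 1)"
    using n r_ge_1 by (simp add: mult_right_mono)
qed (use high_temperature in auto)

end

section \<open>The convex Sobolev inequalities\<close>

lemma Phi_sym: "Phi \<phi> a b = Phi \<phi> b a"
  by (simp add: Phi_def algebra_simps)

lemma tangent_if_convex:
  fixes \<phi> :: "real \<Rightarrow> real"
  assumes conv: "convex_on {0..} \<phi>" and d: "(\<phi> has_real_derivative D) (at a)" and "a > 0" "b > 0"
  shows "\<phi> b \<ge> \<phi> a + D * (b - a)"
proof -
  have "\<phi> b - \<phi> a \<ge> D * (b - a)"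
    using assms by (intro convex_on_imp_above_tangent[OF conv]) (auto intro: has_field_derivative_at_within)
  then show ?thesis by simp
qed

lemma nonpos_if_le_small_multiples:
  fixes x y h0 :: real
  assumes "h0 > 0" and le: "\<And>h. 0 < h \<Longrightarrow> h \<le> h0 \<Longrightarrow> x \<le> h * y"
  shows "x \<le> 0"
proof -
  have "((\<lambda>h. h * y) \<longlongrightarrow> 0 * y) (at_right 0)"
    by (intro tendsto_intros)
  moreover have "eventually (\<lambda>h. x \<le> h * y) (at_right 0)"
    using eventually_at_right_less eventually_at_right_real[OF \<open>h0 > 0\<close>]
    by eventually_elim (use le in auto)
  ultimately have "x \<le> 0 * y"
    by (intro tendsto_lowerbound) auto
  then show ?thesis by simp
qed

context curie_weiss
begin

text \<open>The common core of the three inequalities; \<open>k'\<close> is the rate gained beyond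
  convexity.\<close>

lemma convex_Sobolev_if_merge_contracts:
  assumes tangent: "\<And>a b. a > 0 \<Longrightarrow> b > 0 \<Longrightarrow> \<phi> b \<ge> \<phi> a + deriv \<phi> a * (b - a)"
    and cont: "\<And>a. a > 0 \<Longrightarrow> isCont \<phi> a"
    and conv: "convex_on ({0<..} \<times> {0<..}) (\<lambda>(a, b). Phi \<phi> a b)"
    and merge: "merge_contracts (Phi \<phi>) (kappa_bar_CW \<beta> N) (kappa_CW \<beta> N) k'" and k': "k' \<ge> 0"
  shows "convex_Sobolev (configs N) (moves N) (rate_CW \<beta> N) \<mu> \<phi> (kappa_CW \<beta> N + k')"
  unfolding convex_Sobolev_def
proof (intro allI impI)
  fix f :: "config \<Rightarrow> real"
  assume f: "\<forall>x\<in>configs N. 0 < f x"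
  define k where "k = kappa_CW \<beta> N"
  \<comment> \<open>Steps up to \<open>h0\<close> satisfy the hypothesis of
    \<open>energy_step_le\<close>; they also keep the total jump weight below 1 and give h * k \<le>
    1/2, since k \<le> 2 * exp \<beta>.\<close>
  define h0 where "h0 = 1 / (4 * (real N * exp \<beta>))"
  let ?E = "chain.energy (Phi \<phi>) f" and ?H = "phi_entropy (configs N) \<mu> \<phi> f"
  have k: "k > 0" using kappa_CW_pos by (simp add: k_def)
  have h0: "h0 > 0" using N by (simp add: h0_def)
  have Phi_nonneg: "Phi \<phi> a b \<ge> 0" if "a > 0" "b > 0" for a b
    using tangent[OF that] tangent[OF that(2,1)] by (simp add: Phi_def algebra_simps)
  \<comment> \<open>At fixed \<open>h\<close> only the rate k + k' - 2 * h * k * k' is reached; the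
    deficit is \<open>h\<close> times a number independent of \<open>h\<close>.\<close>
  have "(k + k') * ?H - ?E \<le> h * (2 * k * k' * ?H)" if h: "0 < h" "h \<le> h0" for h
  proof -
    have h_le: "4 * h * real N * exp \<beta> \<le> 1"
      using h N by (simp add: h0_def field_simps)
    have "1 * (h * exp \<beta>) \<le> real N * (h * exp \<beta>)" using N h by (intro mult_right_mono) auto
    then have h_exp: "4 * (h * exp \<beta>) \<le> 1" using h_le by (simp add: mult_ac)
    have hc: "\<forall>x\<in>configs N. h * (\<Sum>i\<in>{1..N}. c x i) < 1"
    proof
      fix x assume "x \<in> configs N"
      then have "(\<Sum>i\<in>{1..N}. c x i) \<le> (\<Sum>i\<in>{1..N}. exp \<beta>)" by (intro sum_mono rate_le)
      then have "h * (\<Sum>i\<in>{1..N}. c x i) \<le> h * (real N * exp \<beta>)"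
        using h by (intro mult_left_mono) auto
      then show "h * (\<Sum>i\<in>{1..N}. c x i) < 1" using h_le by (simp add: mult_ac)
    qed
    obtain x where x: "x \<in> configs N" using configs_not_empty by blast
    have i: "1 \<in> {1..N}" using N by simp
    have "k \<le> 2 * exp \<beta>"
      using kappa_CW_le_merge_rates[OF x i] merge_rate_le[OF x i]
        merge_rate_le[OF flip_in_configs[OF i x] i] by (simp add: k_def)
    then have "h * k \<le> h * (2 * exp \<beta>)" using h by (intro mult_left_mono) auto
    then have hk: "h * k \<le> 1 / 2" using h_exp by simp
    have "(k + k' - 2 * h * k * k') * ?H \<le> ?E"
    proof (rule chain.entropy_le_energy[OF tangent cont f h(1) hc, of "1 - h * k"])
      show "0 \<le> 1 - h * k" "1 - h * k < 1" using hk h k by auto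
      \<comment> \<open>The squared difference contracts by convexity alone, with extra rate 0; the
        factor is below 1 because k > 0.\<close>
      show "chain.energy (\<lambda>a b. (b - a)\<^sup>2) (chain.step h g)
          \<le> (1 - h * k) * chain.energy (\<lambda>a b. (b - a)\<^sup>2) g" if g: "\<forall>x\<in>configs N. 0 < g x" for g
        using energy_step_le[OF convex_on_square_diff _ _ _ _ _ _ _ _ g h(1) h_le, of "kappa_bar_CW \<beta> N" k 0]
          merge_contracts_convex[OF convex_on_square_diff, of "kappa_bar_CW \<beta> N" k]
          kappa_bar_CW_nonneg kappa_bar_CW_le_merge_rate kappa_CW_le_merge_rates k
        by (simp add: power2_commute k_def)
      have "2 * (h * k) * k' \<le> 1 * k'" using hk k' by (intro mult_right_mono) auto
      then show "0 \<le> k + k' - 2 * h * k * k'" using k by (simp add: mult_ac)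
      show "chain.energy (Phi \<phi>) (chain.step h g)
          \<le> (1 - h * (k + k' - 2 * h * k * k')) * chain.energy (Phi \<phi>) g"
        if g: "\<forall>x\<in>configs N. 0 < g x" for g
        unfolding k_def
        by (rule energy_step_le[OF conv Phi_nonneg Phi_sym merge kappa_bar_CW_nonneg
              kappa_bar_CW_le_merge_rate _ k' kappa_CW_le_merge_rates g h(1) h_le])
          (use k k_def in auto)
    qed
    then show ?thesis by (simp add: algebra_simps)
  qed
  then have "(k + k') * ?H - ?E \<le> 0" by (rule nonpos_if_le_small_multiples[OF h0])
  then show "(kappa_CW \<beta> N + k') * ?H
      \<le> 1 / 2 * (\<Sum>x\<in>configs N. \<Sum>\<sigma>\<in>moves N. rate_CW \<beta> N x \<sigma> * Phi \<phi> (f x) (f (\<sigma> x)) * \<mu> x)"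
    unfolding k_def chain.energy_def sum_moves by simp
qed

lemma convex_Sobolev_admissible:
  assumes "admissible \<phi>"
  shows "convex_Sobolev (configs N) (moves N) (rate_CW \<beta> N) \<mu> \<phi> (kappa_CW \<beta> N)"
proof -
  have conv: "convex_on {0..} \<phi>" "convex_on ({0<..} \<times> {0<..}) (\<lambda>(a, b). Phi \<phi> a b)"
    and d: "(\<phi> has_real_derivative deriv \<phi> a) (at a)" if "a > 0" for a
    using assms that by (auto simp: admissible_def DERIV_deriv_iff_real_differentiable)
  note conv = conv[OF zero_less_one]
  have tangent: "\<phi> b \<ge> \<phi> a + deriv \<phi> a * (b - a)" if "a > 0" "b > 0" for a b
    using tangent_if_convex[OF conv(1) d that] that by simp
  have "Phi \<phi> a b \<ge> 0" if "a > 0" "b > 0" for a b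
    using tangent[OF that] tangent[OF that(2,1)] by (simp add: Phi_def algebra_simps)
  then have "merge_contracts (Phi \<phi>) (kappa_bar_CW \<beta> N) (kappa_CW \<beta> N) 0"
    by (intro merge_contracts_convex conv kappa_bar_CW_nonneg) (auto simp: Phi_def)
  then have "convex_Sobolev (configs N) (moves N) (rate_CW \<beta> N) \<mu> \<phi> (kappa_CW \<beta> N + 0)"
    by (intro convex_Sobolev_if_merge_contracts tangent conv) (auto intro: DERIV_isCont d)
  then show ?thesis by simp
qed

section \<open>The logarithmic entropy\<close>

lemma phi_log_deriv: "a > 0 \<Longrightarrow> (phi_log has_real_derivative ln a) (at a)"
  unfolding phi_log_def[abs_def] by (auto intro!: derivative_eq_intros)

lemma modified_log_Sobolev_CW:
  "modified_log_Sobolev (configs N) (moves N) (rate_CW \<beta> N) \<mu> (kappa_CW \<beta> N + 2 * kappa_bar_CW \<beta> N)"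
  unfolding modified_log_Sobolev_def
proof (rule convex_Sobolev_if_merge_contracts)
  have deriv: "deriv phi_log a = ln a" if "a > 0" for a
    using phi_log_deriv[OF that] by (rule DERIV_imp_deriv)
  have Phi: "Phi phi_log a b = 1 * ((ln b - ln a) * (b - a))" if "a > 0" "b > 0" for a b
    using that by (simp add: Phi_def deriv)
  show "convex_on ({0<..} \<times> {0<..}) (\<lambda>(a, b). Phi phi_log a b)"
    by (rule convex_on_scale[OF convex_on_ln_increment_product Phi]) auto
  show "merge_contracts (Phi phi_log) (kappa_bar_CW \<beta> N) (kappa_CW \<beta> N) (2 * kappa_bar_CW \<beta> N)"
    by (rule merge_contracts_scale[OF merge_contracts_ln Phi]) (use kappa_bar_CW_nonneg in auto)
  show "phi_log b \<ge> phi_log a + deriv phi_log a * (b - a)" if ab: "a > 0" "b > 0" for a b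
  proof -
    \<comment> \<open>Divided by b, the tangent inequality for \<open>phi_log\<close> is this bound
      on the logarithm.\<close>
    have "ln (a / b) \<le> a / b - 1" using ab by (intro ln_le_minus_one) auto
    then have "b * (ln a - ln b) \<le> a - b" using ab by (simp add: ln_div field_simps)
    then show ?thesis using ab by (simp add: phi_log_def deriv algebra_simps)
  qed
  show "isCont phi_log a" if "a > 0" for a using phi_log_deriv[OF that] by (rule DERIV_isCont)
qed (use kappa_bar_CW_nonneg in auto)

section \<open>The power entropies\<close>

lemma phi_pow_deriv:
  "\<alpha> \<noteq> 1 \<Longrightarrow> a > 0 \<Longrightarrow> (phi_pow \<alpha> has_real_derivative 1 / (\<alpha> - 1) * (\<alpha> * a powr (\<alpha> - 1) - 1) - 1) (at a)"
  unfolding phi_pow_def[abs_def] by (auto intro!: derivative_eq_intros)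

lemma Beckner_CW:
  assumes \<alpha>: "1 < \<alpha>" "\<alpha> \<le> 2"
  shows "Beckner (configs N) (moves N) (rate_CW \<beta> N) \<mu> \<alpha> (\<alpha> * kappa_CW \<beta> N)"
proof -
  define p where "p = \<alpha> - 1"
  have p: "0 < p" "p \<le> 1" and \<alpha>1: "\<alpha> \<noteq> 1" using \<alpha> by (auto simp: p_def)
  have deriv: "deriv (phi_pow \<alpha>) a = 1 / p * (\<alpha> * a powr p - 1) - 1" if "a > 0" for a
    unfolding p_def by (rule DERIV_imp_deriv[OF phi_pow_deriv[OF \<alpha>1 that]])
  have Phi: "Phi (phi_pow \<alpha>) a b = \<alpha> / p * ((b powr p - a powr p) * (b - a))"
    if "a > 0" "b > 0" for a b
    using that p by (simp add: Phi_def deriv field_simps)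
  have "convex_Sobolev (configs N) (moves N) (rate_CW \<beta> N) \<mu> (phi_pow \<alpha>) (kappa_CW \<beta> N + p * kappa_CW \<beta> N)"
  proof (rule convex_Sobolev_if_merge_contracts)
    show "convex_on ({0<..} \<times> {0<..}) (\<lambda>(a, b). Phi (phi_pow \<alpha>) a b)"
      by (rule convex_on_scale[OF convex_on_powr_increment_product[OF p] Phi]) (use p \<alpha> in auto)
    show "merge_contracts (Phi (phi_pow \<alpha>)) (kappa_bar_CW \<beta> N) (kappa_CW \<beta> N) (p * kappa_CW \<beta> N)"
      by (rule merge_contracts_scale[OF merge_contracts_powr[OF p] Phi])
        (use kappa_bar_CW_nonneg kappa_CW_pos p \<alpha> in auto)
    show "phi_pow \<alpha> b \<ge> phi_pow \<alpha> a + deriv (phi_pow \<alpha>) a * (b - a)" if ab: "a > 0" "b > 0" for a b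
    proof -
      have "convex_on {0<..} (phi_pow \<alpha>)"
      proof (rule f''_ge0_imp_convex)
        fix x :: real assume "x \<in> {0<..}"
        then have x: "x > 0" by simp
        show "(phi_pow \<alpha> has_real_derivative 1 / (\<alpha> - 1) * (\<alpha> * x powr (\<alpha> - 1) - 1) - 1) (at x)"
          by (rule phi_pow_deriv[OF \<alpha>1 x])
        show "((\<lambda>x. 1 / (\<alpha> - 1) * (\<alpha> * x powr (\<alpha> - 1) - 1) - 1) has_real_derivative
            \<alpha> * x powr (\<alpha> - 2)) (at x)"
          using x \<alpha> by (auto intro!: derivative_eq_intros)
        show "\<alpha> * x powr (\<alpha> - 2) \<ge> 0" using \<alpha> by simp
      qed simp
      from convex_on_imp_above_tangent[OF this, of a b] ab
      have "phi_pow \<alpha> b - phi_pow \<alpha> a \<ge> deriv (phi_pow \<alpha>) a * (b - a)"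
        using phi_pow_deriv[OF \<alpha>1 ab(1)]
        by (auto simp: deriv p_def interior_open intro!: has_field_derivative_at_within)
      then show ?thesis by simp
    qed
    show "isCont (phi_pow \<alpha>) a" if "a > 0" for a by (rule DERIV_isCont[OF phi_pow_deriv[OF \<alpha>1 that]])
  qed (use p kappa_CW_pos in auto)
  then show ?thesis by (simp add: Beckner_def p_def algebra_simps)
qed

end

text \<open>The middle is the integer (N - 1) / 2 itself, so both exponential prefactors are
  1.\<close>

lemma f_CW_odd:
  assumes "odd N"
  shows "f_CW \<beta> N \<lfloor>(real N - 1) / 2\<rfloor> = 2 * (1 - (real N - 1) / 2 * (exp (2 * \<beta> / real N) - 1))"
proof -
  obtain k where "N = 2 * k + 1" using assms by (elim oddE)
  then have N: "real N - 1 = 2 * real k" by simp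
  have "\<lfloor>(real N - 1) / 2\<rfloor> = int k" unfolding N by simp
  then show ?thesis unfolding f_CW_def N by simp
qed

theorem theorem4p2:
  fixes N :: nat and \<beta> :: real
  assumes "N \<ge> 1" and "\<beta> > 0"
    and "(real N - 1) * (exp (2 * \<beta> / real N) - 1) \<le> 1"
  shows "(\<forall>\<phi>. admissible \<phi> \<longrightarrow>
            convex_Sobolev (configs N) (moves N) (rate_CW \<beta> N) (gibbs_CW \<beta> N) \<phi> (kappa_CW \<beta> N))
       \<and> modified_log_Sobolev (configs N) (moves N) (rate_CW \<beta> N) (gibbs_CW \<beta> N)
            (kappa_CW \<beta> N + 2 * kappa_bar_CW \<beta> N)
       \<and> (\<forall>\<alpha>. 1 < \<alpha> \<and> \<alpha> \<le> 2 \<longrightarrow>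
            Beckner (configs N) (moves N) (rate_CW \<beta> N) (gibbs_CW \<beta> N) \<alpha> (\<alpha> * kappa_CW \<beta> N))
       \<and> (odd N \<longrightarrow>
            f_CW \<beta> N \<lfloor>(real N - 1) / 2\<rfloor>
              = 2 * (1 - (real N - 1) / 2 * (exp (2 * \<beta> / real N) - 1)))"
proof -
  interpret curie_weiss N \<beta> using assms by unfold_locales
  show ?thesis
    using convex_Sobolev_admissible modified_log_Sobolev_CW Beckner_CW f_CW_odd by blast
qed

end
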